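(* Let $\mathbb{K}$ be a field of characteristic zero, let $r\in\mathbb{N}$ with $r\ge 2$, and let $a\ge b$ be the integer square roots of $\binom{r}{2}$. Then there exists a faithful nilrepresentation of $\mathcal{L}_{r,2}$ of type $(a,2,b)$. In particular \[ \mu(\mathcal{L}_{r,2}) \leq a+b+2= \left\lceil \sqrt{2r(r-1)} \right\rceil + 2. \]
   Context: All vector spaces, Lie algebras and representations are finite dimensional over a field $\mathbb{K}$ of characteristic zero. The free $2$-step nilpotent Lie algebra of rank $r$ is $\mathcal{L}_{r,2}=\mathbb{K}^r\oplus\bigwedge^2\mathbb{K}^r$ with bracket $[X,Y]=X\wedge Y$ for $X,Y\in\mathbb{K}^r$ and with $\bigwedge^2\mathbb{K}^r$ central. For a Lie algebra $\mathfrak{g}$, $\mu(\mathfrak{g})$ is the minimal dimension of a faithful (i.e. injective) representation of $\mathfrak{g}$. A representation $(\pi,V)$ is a nilrepresentation if $\pi(X)$ is a nilpotent endomorphism for every $X\in\mathfrak{g}$. Type $(a,p,b)$: for natural numbers $a,p,b$, a representation $\pi:\mathcal{L}_{r,2}\to\mathfrak{gl}(V)$ is of type $(a,p,b)$ if $V$ has a basis $\{u_1,\dots,u_a,v_1,\dots,v_p,w_1,\dots,w_b\}$ (so $\dim V=a+p+b$) with respect to which, for every $X\in\mathcal{L}_{r,2}$, the matrix of $\pi(X)$ has the block form \[ \begin{pmatrix} 0 & * & *\\ 0&0&*\\ 0&0&0\end{pmatrix} \] with diagonal blocks of sizes $a$, $p$, $b$ respectively. Integer square roots: given $n\in\mathbb{N}$,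 the integer square roots of $n$ are the numbers $a\ge b$ defined by $a=\lceil\sqrt{n}\,\rceil$, and $b=a-1$ if $a(a-1)\ge n$, $b=a$ if $a(a-1)<n$. *)

theory Defs
  imports Complex_Main "HOL-Library.Function_Algebras" "HOL-Library.Product_Plus" "HOL-Library.FuncSet"
begin

(* Spaces whose dimension is a variable natural number are rendered as finite-dimensional
   subspaces of an ambient vector space type.  The spanning condition below already says
   that V is a subspace. *)

locale fin_dim_subspace = vector_space scale
  for scale :: "'k::field_char_0 \<Rightarrow> 'v::ab_group_add \<Rightarrow> 'v" +
  fixes V :: "'v set"
  assumes finite_span: "\<exists>B. finite B \<and> span B = V"

locale lie_algebra = fin_dim_subspace scale \<gg>
  for scale :: "'k::field_char_0 \<Rightarrow> 'g::ab_group_add \<Rightarrow> 'g" and \<gg> :: "'g set" +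
  fixes bracket :: "'g \<Rightarrow> 'g \<Rightarrow> 'g"
  assumes bracket_closed: "\<lbrakk>X \<in> \<gg>; Y \<in> \<gg>\<rbrakk> \<Longrightarrow> bracket X Y \<in> \<gg>"
    and bracket_add_left: "\<lbrakk>X \<in> \<gg>; Y \<in> \<gg>; Z \<in> \<gg>\<rbrakk> \<Longrightarrow> bracket (X + Y) Z = bracket X Z + bracket Y Z"
    and bracket_add_right: "\<lbrakk>X \<in> \<gg>; Y \<in> \<gg>; Z \<in> \<gg>\<rbrakk> \<Longrightarrow> bracket X (Y + Z) = bracket X Y + bracket X Z"
    and bracket_scale_left: "\<lbrakk>X \<in> \<gg>; Y \<in> \<gg>\<rbrakk> \<Longrightarrow> bracket (scale c X) Y = scale c (bracket X Y)"
    and bracket_scale_right: "\<lbrakk>X \<in> \<gg>; Y \<in> \<gg>\<rbrakk> \<Longrightarrow> bracket X (scale c Y) = scale c (bracket X Y)"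
    and bracket_self: "X \<in> \<gg> \<Longrightarrow> bracket X X = 0"
    and jacobi: "\<lbrakk>X \<in> \<gg>; Y \<in> \<gg>; Z \<in> \<gg>\<rbrakk> \<Longrightarrow>
      bracket X (bracket Y Z) + bracket Y (bracket Z X) + bracket Z (bracket X Y) = 0"

(* The values of \<pi> X outside V and of \<pi> outside \<gg> are irrelevant. *)

locale lie_representation =
  L: lie_algebra scaleL \<gg> bracket + V: fin_dim_subspace scaleV V
  for scaleL :: "'k::field_char_0 \<Rightarrow> 'g::ab_group_add \<Rightarrow> 'g" and \<gg> bracket
    and scaleV :: "'k \<Rightarrow> 'v::ab_group_add \<Rightarrow> 'v" and V +
  fixes \<pi> :: "'g \<Rightarrow> 'v \<Rightarrow> 'v"
  assumes rep_closed: "\<lbrakk>X \<in> \<gg>; v \<in> V\<rbrakk> \<Longrightarrow> \<pi> X v \<in> V"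
    and endo_add: "\<lbrakk>X \<in> \<gg>; u \<in> V; v \<in> V\<rbrakk> \<Longrightarrow> \<pi> X (u + v) = \<pi> X u + \<pi> X v"
    and endo_scale: "\<lbrakk>X \<in> \<gg>; v \<in> V\<rbrakk> \<Longrightarrow> \<pi> X (scaleV c v) = scaleV c (\<pi> X v)"
    and rep_add: "\<lbrakk>X \<in> \<gg>; Y \<in> \<gg>; v \<in> V\<rbrakk> \<Longrightarrow> \<pi> (X + Y) v = \<pi> X v + \<pi> Y v"
    and rep_scale: "\<lbrakk>X \<in> \<gg>; v \<in> V\<rbrakk> \<Longrightarrow> \<pi> (scaleL c X) v = scaleV c (\<pi> X v)"
    and rep_bracket: "\<lbrakk>X \<in> \<gg>; Y \<in> \<gg>; v \<in> V\<rbrakk> \<Longrightarrow>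
      \<pi> (bracket X Y) v = \<pi> X (\<pi> Y v) - \<pi> Y (\<pi> X v)"

locale faithful_representation = lie_representation +
  assumes faithful: "inj_on (\<lambda>X. restrict (\<pi> X) V) \<gg>"

locale nilrepresentation = lie_representation +
  assumes nilpotent: "X \<in> \<gg> \<Longrightarrow> \<exists>k. \<forall>v\<in>V. (\<pi> X ^^ k) v = 0"

definition (in vector_space) ordered_basis :: "nat \<Rightarrow> (nat \<Rightarrow> 'b) \<Rightarrow> 'b set \<Rightarrow> bool" where
  "ordered_basis n e V \<longleftrightarrow> inj_on e {..<n} \<and> independent (e ` {..<n}) \<and> span (e ` {..<n}) = V"

definition (in vector_space) matrix_entry ::
    "nat \<Rightarrow> (nat \<Rightarrow> 'b) \<Rightarrow> ('b \<Rightarrow> 'b) \<Rightarrow> nat \<Rightarrow> nat \<Rightarrow> 'a" where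
  "matrix_entry n e f i j = representation (e ` {..<n}) (f (e j)) (e i)"

definition block_index :: "nat \<Rightarrow> nat \<Rightarrow> nat \<Rightarrow> nat" where
  "block_index a p i = (if i < a then 0 else if i < a + p then 1 else 2)"

(* Rows and columns are numbered from 0: indices below a belong to the u's, the next p to the
   v's and the last b to the w's. *)

locale representation_of_type = lie_representation +
  fixes a p b :: nat
  assumes block_form: "\<exists>e. V.ordered_basis (a + p + b) e V \<and>
    (\<forall>X\<in>\<gg>. \<forall>i < a + p + b. \<forall>j < a + p + b.
       block_index a p j \<le> block_index a p i \<longrightarrow> V.matrix_entry (a + p + b) e (\<pi> X) i j = 0)"

definition fun_scale :: "'k::field \<Rightarrow> ('i \<Rightarrow> 'k) \<Rightarrow> 'i \<Rightarrow> 'k" where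
  "fun_scale c f = (\<lambda>i. c * f i)"

(* Representations on subspaces of the functions from nat to the field suffice, because
   every finite-dimensional space is isomorphic to such a subspace; see minimal_faithful_dim_le. *)

definition minimal_faithful_dim ::
    "('k::field_char_0 \<Rightarrow> 'g::ab_group_add \<Rightarrow> 'g) \<Rightarrow> 'g set \<Rightarrow> ('g \<Rightarrow> 'g \<Rightarrow> 'g) \<Rightarrow> nat" where
  "minimal_faithful_dim scaleL \<gg> bracket =
     (LEAST n. \<exists>(V :: (nat \<Rightarrow> 'k) set) \<pi>.
        faithful_representation scaleL \<gg> bracket fun_scale V \<pi> \<and> vector_space.dim fun_scale V = n)"

lemma vector_space_fun_scale: "vector_space (fun_scale :: 'k::field \<Rightarrow> ('i \<Rightarrow> 'k) \<Rightarrow> _)"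
  by unfold_locales (auto simp: fun_scale_def plus_fun_def algebra_simps)

interpretation fun_vs: vector_space "fun_scale :: 'k::field \<Rightarrow> ('i \<Rightarrow> 'k) \<Rightarrow> _"
  by (rule vector_space_fun_scale)

(* K^r is the space of functions on nat vanishing at all indices >= r.  The element sum of w (i,j) e_i \<and> e_j (over i < j < r) of the exterior square of K^r is
   encoded by its coefficient function w. *)

definition wedge :: "(nat \<Rightarrow> 'k::field) \<Rightarrow> (nat \<Rightarrow> 'k) \<Rightarrow> nat \<times> nat \<Rightarrow> 'k" where
  "wedge x y = (\<lambda>(i, j). if i < j then x i * y j - x j * y i else 0)"

definition free_nil2 :: "nat \<Rightarrow> ((nat \<Rightarrow> 'k::field) \<times> (nat \<times> nat \<Rightarrow> 'k)) set" where
  "free_nil2 r = {(x, w). (\<forall>i. x i \<noteq> 0 \<longrightarrow> i < r) \<and> (\<forall>i j. w (i, j) \<noteq> 0 \<longrightarrow> i < j \<and> j < r)}"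

definition free_nil2_scale ::
    "'k::field \<Rightarrow> (nat \<Rightarrow> 'k) \<times> (nat \<times> nat \<Rightarrow> 'k) \<Rightarrow> (nat \<Rightarrow> 'k) \<times> (nat \<times> nat \<Rightarrow> 'k)" where
  "free_nil2_scale c = (\<lambda>(x, w). (fun_scale c x, fun_scale c w))"

definition free_nil2_bracket ::
    "(nat \<Rightarrow> 'k::field) \<times> (nat \<times> nat \<Rightarrow> 'k) \<Rightarrow> (nat \<Rightarrow> 'k) \<times> (nat \<times> nat \<Rightarrow> 'k) \<Rightarrow>
     (nat \<Rightarrow> 'k) \<times> (nat \<times> nat \<Rightarrow> 'k)" where
  "free_nil2_bracket = (\<lambda>(x, w) (y, z). (0, wedge x y))"

(* Meant for n > 0; for n = 0 truncated subtraction yields (0, 0). *)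

definition integer_square_roots :: "nat \<Rightarrow> nat \<times> nat" where
  "integer_square_roots n =
     (let a = nat \<lceil>sqrt (real n)\<rceil> in (a, if a * (a - 1) \<ge> n then a - 1 else a))"

definition unit_fun :: "'i \<Rightarrow> 'i \<Rightarrow> 'k::field" where
  "unit_fun i = (\<lambda>j. if j = i then 1 else 0)"

lemma sum_fun_apply: "(\<Sum>i\<in>A. f i) x = (\<Sum>i\<in>A. f i x)"
  for f :: "'a \<Rightarrow> 'b \<Rightarrow> 'c::comm_monoid_add"
  by (induction A rule: infinite_finite_induct) auto

lemma sum_unit_fun:
  assumes "finite I" "\<forall>i. i \<notin> I \<longrightarrow> c i = 0"
  shows "(\<Sum>i\<in>I. fun_scale (c i) (unit_fun i)) = c"
proof
  fix j
  have "(\<Sum>i\<in>I. fun_scale (c i) (unit_fun i)) j = (\<Sum>i\<in>I. if i = j then c j else 0)"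
    unfolding sum_fun_apply by (intro sum.cong) (auto simp: fun_scale_def unit_fun_def)
  then show "(\<Sum>i\<in>I. fun_scale (c i) (unit_fun i)) j = c j"
    using assms by simp
qed

lemma span_unit_fun:
  assumes "finite I"
  shows "fun_vs.span (unit_fun ` I :: ('i \<Rightarrow> 'k::field) set) = {c. \<forall>i. i \<notin> I \<longrightarrow> c i = 0}" (is "?L = ?W")
proof
  show "?L \<subseteq> ?W"
    by (rule fun_vs.span_minimal)
      (auto simp: unit_fun_def fun_vs.subspace_def fun_scale_def)
  show "?W \<subseteq> ?L"
  proof
    fix c :: "'i \<Rightarrow> 'k" assume "c \<in> ?W"
    then have "c = (\<Sum>i\<in>I. fun_scale (c i) (unit_fun i))"
      using sum_unit_fun[OF assms, of c] by simp
    also have "\<dots> \<in> ?L"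
      by (intro fun_vs.span_sum fun_vs.span_scale fun_vs.span_base) auto
    finally show "c \<in> ?L" .
  qed
qed

lemma inj_unit_fun: "inj (unit_fun :: 'i \<Rightarrow> 'i \<Rightarrow> 'k::field)"
  by (auto simp: inj_on_def unit_fun_def fun_eq_iff split: if_splits)

lemma independent_unit_fun:
  assumes "finite I"
  shows "fun_vs.independent (unit_fun ` I :: ('i \<Rightarrow> 'k::field) set)"
proof (rule fun_vs.independent_if_scalars_zero)
  show "finite (unit_fun ` I)" using assms by simp
  fix f :: "('i \<Rightarrow> 'k) \<Rightarrow> 'k" and v :: "'i \<Rightarrow> 'k"
  assume z: "(\<Sum>x\<in>unit_fun ` I. fun_scale (f x) x) = 0" and v: "v \<in> unit_fun ` I"
  obtain j where j: "v = unit_fun j" "j \<in> I" using v by auto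
  define c where "c = (\<lambda>i. if i \<in> I then f (unit_fun i) else 0)"
  have "0 = (\<Sum>i\<in>I. fun_scale (f (unit_fun i)) (unit_fun i))"
    using z by (simp add: sum.reindex[OF inj_on_subset[OF inj_unit_fun subset_UNIV]])
  also have "\<dots> = (\<Sum>i\<in>I. fun_scale (c i) (unit_fun i))"
    by (intro sum.cong) (auto simp: c_def)
  also have "\<dots> = c" using assms by (intro sum_unit_fun) (auto simp: c_def)
  finally have "c j = 0" by (metis zero_fun_apply)
  then show "f v = 0" using j by (simp add: c_def)
qed

lemma minimal_faithful_dim_le:
  assumes "faithful_representation scaleL \<gg> bracket scaleV V \<pi>"
  shows "minimal_faithful_dim scaleL \<gg> bracket \<le> vector_space.dim scaleV V"
proof -
  interpret faithful_representation scaleL \<gg> bracket scaleV V \<pi> by fact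
  obtain S where S: "finite S" "V.span S = V" using V.finite_span by auto
  obtain B where B: "B \<subseteq> V" "V.independent B" "V \<subseteq> V.span B" "card B = V.dim V"
    using V.basis_exists by blast
  have finB: "finite B" using V.independent_span_bound[OF S(1) B(2)] B(1) S(2) by auto
  have subV: "V.subspace V" using S(2) V.subspace_span by metis
  have spanB: "V.span B = V" using B subV by (metis V.span_subspace)
  define n where "n = card B"
  obtain h where h: "bij_betw h {..<n} B"
    using ex_bij_betw_nat_finite[OF finB] by (auto simp: n_def atLeast0LessThan)
  have hB: "h i \<in> B" if "i < n" for i using h that by (auto simp: bij_betw_def)
  define W where "W = {c :: nat \<Rightarrow> 'a. \<forall>i. i \<notin> {..<n} \<longrightarrow> c i = 0}"
  define \<phi> where "\<phi> = (\<lambda>v i. if i < n then V.representation B v (h i) else 0)"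
  define \<psi> where "\<psi> = (\<lambda>c. \<Sum>i<n. scaleV (c i) (h i))"
  have \<phi>W: "\<phi> v \<in> W" for v by (auto simp: \<phi>_def W_def)
  have \<psi>V: "\<psi> c \<in> V" for c
    unfolding \<psi>_def using hB B(1) subV
    by (intro V.subspace_sum V.subspace_scale) auto
  have \<psi>\<phi>: "\<psi> (\<phi> v) = v" if "v \<in> V" for v
  proof -
    have "\<psi> (\<phi> v) = (\<Sum>i<n. scaleV (V.representation B v (h i)) (h i))"
      by (simp add: \<psi>_def \<phi>_def)
    also have "\<dots> = (\<Sum>b\<in>B. scaleV (V.representation B v b) b)"
      using sum.reindex_bij_betw[OF h, of "\<lambda>b. scaleV (V.representation B v b) b"] by simp
    also have "\<dots> = v"
      using V.sum_representation_eq[OF B(2), of v B] that spanB finB by simp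
    finally show ?thesis .
  qed
  have \<phi>add: "\<phi> (u + v) = \<phi> u + \<phi> v" if "u \<in> V" "v \<in> V" for u v
    using that spanB by (auto simp: \<phi>_def V.representation_add[OF B(2)])
  have \<phi>scale: "\<phi> (scaleV c v) = fun_scale c (\<phi> v)" if "v \<in> V" for c v
    using that spanB by (auto simp: \<phi>_def V.representation_scale[OF B(2)] fun_scale_def)
  have \<phi>diff: "\<phi> (u - v) = \<phi> u - \<phi> v" if "u \<in> V" "v \<in> V" for u v
    using that spanB by (auto simp: \<phi>_def V.representation_diff[OF B(2)])
  have \<psi>add: "\<psi> (c + d) = \<psi> c + \<psi> d" for c d
    by (simp add: \<psi>_def V.scale_left_distrib sum.distrib)
  have \<psi>scale: "\<psi> (fun_scale k c) = scaleV k (\<psi> c)" for k c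
    by (simp add: \<psi>_def V.scale_sum_right fun_scale_def)
  define \<rho> where "\<rho> = (\<lambda>X c. \<phi> (\<pi> X (\<psi> c)))"
  have spanW: "fun_vs.span (unit_fun ` {..<n}) = W"
    unfolding W_def by (rule span_unit_fun) simp
  have "faithful_representation scaleL \<gg> bracket fun_scale W \<rho>"
  proof (unfold_locales, goal_cases)
    case 1
    show ?case using spanW by blast
  next
    case 8
    show ?case
    proof (rule inj_onI)
      fix X Y assume XY: "X \<in> \<gg>" "Y \<in> \<gg>" "restrict (\<rho> X) W = restrict (\<rho> Y) W"
      have "\<pi> X v = \<pi> Y v" if "v \<in> V" for v
      proof -
        have "\<rho> X (\<phi> v) = \<rho> Y (\<phi> v)" using XY(3) \<phi>W by (metis restrict_apply')
        then show ?thesis using that XY rep_closed \<psi>\<phi> unfolding \<rho>_def by metis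
      qed
      then have "restrict (\<pi> X) V = restrict (\<pi> Y) V" by (auto simp: restrict_def)
      then show "X = Y" using faithful XY by (auto dest: inj_onD)
    qed
  qed (simp_all add: \<rho>_def \<phi>W \<psi>V \<psi>\<phi> \<phi>add \<phi>scale \<phi>diff \<psi>add \<psi>scale rep_closed endo_add endo_scale
      rep_add rep_scale rep_bracket)
  moreover have "fun_vs.dim W = V.dim V"
  proof -
    have "fun_vs.dim W = card (unit_fun ` {..<n} :: (nat \<Rightarrow> 'a) set)"
      by (metis fun_vs.dim_span_eq_card_independent independent_unit_fun finite_lessThan spanW)
    also have "\<dots> = n" by (simp add: card_image inj_unit_fun inj_on_subset[OF inj_unit_fun])
    finally show ?thesis using B n_def by simp
  qed
  ultimately show ?thesis
    unfolding minimal_faithful_dim_def by (intro Least_le) blast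
qed

lemma lie_algebra_free_nil2:
  "lie_algebra (free_nil2_scale :: 'k::field_char_0 \<Rightarrow> _) (free_nil2 r) free_nil2_bracket"
proof -
  interpret P: vector_space "free_nil2_scale :: 'k \<Rightarrow> _"
    by unfold_locales (auto simp: free_nil2_scale_def fun_vs.scale_right_distrib fun_vs.scale_left_distrib)
  let ?P = "{(i, j). i < j \<and> j < r}"
  let ?A = "(\<lambda>i. (unit_fun i, 0)) ` {..<r}" and ?C = "(\<lambda>p. (0, unit_fun p)) ` ?P"
  let ?B = "?A \<union> ?C :: ((nat \<Rightarrow> 'k) \<times> (nat \<times> nat \<Rightarrow> 'k)) set"
  have finP: "finite ?P" by (rule finite_subset[of _ "{..<r} \<times> {..<r}"]) auto
  have "P.span ?B \<subseteq> free_nil2 r"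
  proof (rule P.span_minimal)
    show "?B \<subseteq> free_nil2 r" by (auto simp: free_nil2_def unit_fun_def split: if_splits)
    show "P.subspace (free_nil2 r)"
      unfolding P.subspace_def free_nil2_def free_nil2_scale_def fun_scale_def zero_prod_def
      by auto (metis add_0)+
  qed
  moreover have "free_nil2 r \<subseteq> P.span ?B"
  proof
    fix z :: "(nat \<Rightarrow> 'k) \<times> (nat \<times> nat \<Rightarrow> 'k)" assume z: "z \<in> free_nil2 r"
    obtain x w where xw: "z = (x, w)" by fastforce
    let ?s = "(\<Sum>i<r. free_nil2_scale (x i) (unit_fun i, 0)) + (\<Sum>p\<in>?P. free_nil2_scale (w p) (0, unit_fun p))"
    have "fst ?s = (\<Sum>i<r. fun_scale (x i) (unit_fun i))" "snd ?s = (\<Sum>p\<in>?P. fun_scale (w p) (unit_fun p))"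
      by (simp_all add: fst_sum snd_sum free_nil2_scale_def)
    moreover have "(\<Sum>i<r. fun_scale (x i) (unit_fun i)) = x"
      using z xw by (intro sum_unit_fun) (auto simp: free_nil2_def)
    moreover have "(\<Sum>p\<in>?P. fun_scale (w p) (unit_fun p)) = w"
      using z xw finP by (intro sum_unit_fun) (auto simp: free_nil2_def)
    ultimately have "fst ?s = x" "snd ?s = w" by simp_all
    then have "z = ?s" by (intro prod_eqI) (simp_all only: xw fst_conv snd_conv)
    also have "?s \<in> P.span ?B"
      by (intro P.span_add P.span_sum P.span_scale P.span_base) auto
    finally show "z \<in> P.span ?B" .
  qed
  ultimately have "P.span ?B = free_nil2 r" by blast
  moreover have "finite ?B" using finP by simp
  ultimately have "\<exists>B. finite B \<and> P.span B = free_nil2 r" by blast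
  then show ?thesis
  proof (unfold_locales, goal_cases)
    case (2 X Y)
    have "wedge x y (i, j) = 0" if "X = (x, w)" "Y = (y, z)" "\<not> (i < j \<and> j < r)" for x w y z i j
    proof -
      have "x j = 0 \<and> y j = 0 \<or> \<not> i < j"
        using 2(2,3) that by (auto simp: free_nil2_def)
      then show ?thesis by (auto simp: wedge_def)
    qed
    then show ?case
      by (cases X; cases Y) (force simp: free_nil2_def free_nil2_bracket_def)
  qed (auto simp: free_nil2_bracket_def free_nil2_scale_def fun_scale_def wedge_def
        zero_prod_def fun_eq_iff algebra_simps)
qed

end

theory Submission
  imports Defs "HOL-Computational_Algebra.Polynomial"
begin

text \<open>A representation of type \<open>(a, 2, b)\<close> is given by linear forms \<open>F\<close> (the upper middle block) and
  \<open>G\<close> (the middle right block) on \<open>K\<^sup>r\<close>; the upper right block is then forced on brackets. It is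
  faithful as soon as no nonzero skew form \<open>\<Omega>\<close> satisfies
  \<open>\<Sum>p q c. \<Omega> p q * F i (p, c) * G j (q, c) = 0\<close> for all \<open>i < a\<close>, \<open>j < b\<close>. A generic pair has this property
  by a dimension count: stratify the bad pairs by the rank \<open>\<rho>\<close> of \<open>\<Omega>\<close> and the rank \<open>s\<close> of the rows
  obtained by pairing \<open>F\<close> with \<open>\<Omega>\<close>. Each stratum is a finite union of polynomial images of affine spaces
  of dimension less than \<open>2 r (a + b)\<close>, because
  \<open>\<rho> (2 r - \<rho> - 1) / 2 \<le> (a - s) (2 \<rho> - s) + s b\<close>, and over an infinite field finitely many such images
  cannot cover the space of all pairs.\<close>

section \<open>Polynomial maps with few parameters\<close>

text \<open>The annihilation condition is bilinear in F and G, so for a fixed form the bad pairs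
  fall into pieces of different dimension, one for each possible rank s of the paired rows. No
  single count covers them, which is why s enters beside \<rho>. The paired rows live in a space of
  dimension 2 \<rho>, the 2 being the size of the middle block. For s = a and \<rho> = r the
  inequality reads r (r - 1) / 2 <= a b, which is what the integer square roots provide. For \<rho>
  <= a the critical values of s are near \<rho>, and there it matters that a and b differ by at most
  one. The inequality itself is not strict: the last parameter is gained because a form and its
  nonzero multiples annihilate the same pairs, so one entry can be normalized. Dimension is measured
  by counting monomials, since the field need not be algebraically closed: an image with too few
  parameters meets a suitable curve of powers of z in only finitely many points.\<close>

definition monomials :: "'i set \<Rightarrow> nat \<Rightarrow> (('i \<Rightarrow> 'k::field) \<Rightarrow> 'k) set" where
  "monomials V d = (\<lambda>e t. \<Prod>v\<in>V. t v ^ e v) ` (\<Pi>\<^sub>E v\<in>V. {..d})"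

text \<open>Polynomials are taken as functions, and the degree is bounded in each variable
  separately, so that the dimension of the span is at most the number
  \<open>(d + 1) ^ card V\<close> of exponents.\<close>

definition polys_upto :: "'i set \<Rightarrow> nat \<Rightarrow> (('i \<Rightarrow> 'k::field) \<Rightarrow> 'k) set" where
  "polys_upto V d = fun_vs.span (monomials V d)"

definition polys :: "'i set \<Rightarrow> (('i \<Rightarrow> 'k::field) \<Rightarrow> 'k) set" where
  "polys V = (\<Union>d. polys_upto V d)"

lemma finite_monomials: "finite V \<Longrightarrow> finite (monomials V d)"
  unfolding monomials_def by (intro finite_imageI finite_PiE) auto

lemma card_monomials_le: "finite V \<Longrightarrow> card (monomials V d) \<le> (d + 1) ^ card V"
  unfolding monomials_def
  by (rule order_trans[OF card_image_le]) (auto intro: finite_PiE simp: card_PiE)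

lemma monomial_in_monomials:
  assumes "\<And>v. v \<in> V \<Longrightarrow> e v \<le> d"
  shows "(\<lambda>t. \<Prod>v\<in>V. t v ^ e v) \<in> monomials V d"
  unfolding monomials_def
proof (rule image_eqI)
  show "(\<lambda>t. \<Prod>v\<in>V. t v ^ e v) = (\<lambda>t. \<Prod>v\<in>V. t v ^ restrict e V v)"
    by (intro ext prod.cong) auto
  show "restrict e V \<in> (\<Pi>\<^sub>E v\<in>V. {..d})"
    using assms by auto
qed

lemma monomials_mono: "d \<le> d' \<Longrightarrow> monomials V d \<subseteq> monomials V d'"
  unfolding monomials_def by (intro image_mono PiE_mono) auto

lemma polys_upto_mono: "d \<le> d' \<Longrightarrow> polys_upto V d \<subseteq> polys_upto V d'"
  unfolding polys_upto_def by (intro fun_vs.span_mono monomials_mono)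

lemma polys_upto_add: "f \<in> polys_upto V d \<Longrightarrow> g \<in> polys_upto V d \<Longrightarrow> (\<lambda>t. f t + g t) \<in> polys_upto V d"
  using fun_vs.span_add[of f _ g] by (simp add: polys_upto_def plus_fun_def)

lemma polys_upto_scale: "f \<in> polys_upto V d \<Longrightarrow> (\<lambda>t. c * f t) \<in> polys_upto V d"
  using fun_vs.span_scale[of f _ c] by (simp add: polys_upto_def fun_scale_def)

lemma polys_upto_one: "(\<lambda>t. 1) \<in> polys_upto V d"
  using monomial_in_monomials[of V "\<lambda>_. 0" d] unfolding polys_upto_def
  by (auto intro: fun_vs.span_base)

lemma polys_upto_mult:
  assumes f: "f \<in> polys_upto V d" and g: "g \<in> polys_upto V d'"
  shows "(\<lambda>t. f t * g t) \<in> polys_upto V (d + d')"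
proof -
  have mono: "(\<lambda>t. m t * m' t) \<in> polys_upto V (d + d')"
    if m: "m \<in> monomials V d" and m': "m' \<in> monomials V d'" for m m' :: "('a \<Rightarrow> 'b) \<Rightarrow> 'b"
  proof -
    obtain e e' where e: "e \<in> (\<Pi>\<^sub>E v\<in>V. {..d})" "m = (\<lambda>t. \<Prod>v\<in>V. t v ^ e v)"
      and e': "e' \<in> (\<Pi>\<^sub>E v\<in>V. {..d'})" "m' = (\<lambda>t. \<Prod>v\<in>V. t v ^ e' v)"
      using m m' unfolding monomials_def by auto
    have "(\<lambda>t. m t * m' t) = (\<lambda>t. \<Prod>v\<in>V. t v ^ (e v + e' v))"
      by (simp add: e(2) e'(2) power_add prod.distrib)
    also have "\<dots> \<in> monomials V (d + d')"
      using e(1) e'(1) by (intro monomial_in_monomials add_mono) (auto simp: PiE_iff)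
    finally show ?thesis unfolding polys_upto_def by (rule fun_vs.span_base)
  qed
  have zero: "(\<lambda>_. 0) \<in> polys_upto V (d + d')"
    using fun_vs.span_zero by (simp add: polys_upto_def zero_fun_def)
  have "(\<lambda>t. f t * m' t) \<in> polys_upto V (d + d')" if m': "m' \<in> monomials V d'" for m'
    using f unfolding polys_upto_def[of V d]
  proof (induction rule: fun_vs.span_induct_alt)
    case (step c x y)
    have "(\<lambda>t. (c * (x t * m' t)) + y t * m' t) \<in> polys_upto V (d + d')"
      by (intro polys_upto_add polys_upto_scale mono step m')
    then show ?case by (simp add: fun_scale_def algebra_simps)
  qed (simp add: zero)
  note fm = this
  from g show ?thesis unfolding polys_upto_def[of V d']
  proof (induction rule: fun_vs.span_induct_alt)
    case (step c x y)
    have "(\<lambda>t. (c * (f t * x t)) + f t * y t) \<in> polys_upto V (d + d')"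
      by (intro polys_upto_add polys_upto_scale fm step)
    then show ?case by (simp add: fun_scale_def algebra_simps)
  qed (simp add: zero)
qed

lemma polys_upto_power: "f \<in> polys_upto V d \<Longrightarrow> (\<lambda>t. f t ^ n) \<in> polys_upto V (n * d)"
  by (induction n) (auto simp: polys_upto_one dest: polys_upto_mult)

lemma polys_upto_prod:
  assumes "finite A" "\<And>x. x \<in> A \<Longrightarrow> f x \<in> polys_upto V (n x)"
  shows "(\<lambda>t. \<Prod>x\<in>A. f x t) \<in> polys_upto V (\<Sum>x\<in>A. n x)"
  using assms by (induction A rule: finite_induct) (auto simp: polys_upto_one intro: polys_upto_mult)

lemma polys_const: "(\<lambda>t. c) \<in> polys V"
  using polys_upto_scale[OF polys_upto_one, of c V 0] by (auto simp: polys_def)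

lemma polys_var:
  fixes V :: "'i set"
  assumes "finite V" "v \<in> V" shows "(\<lambda>t :: 'i \<Rightarrow> 'k::field. t v) \<in> polys V"
proof -
  define m :: "('i \<Rightarrow> 'k) \<Rightarrow> 'k" where "m = (\<lambda>t. \<Prod>w\<in>V. t w ^ (if w = v then 1 else 0))"
  have "m \<in> monomials V 1"
    unfolding m_def by (intro monomial_in_monomials) auto
  moreover have "m = (\<lambda>t. t v)"
    using assms by (simp add: m_def if_distrib[of "\<lambda>n. _ ^ n"] cong: if_cong)
  ultimately show ?thesis
    unfolding polys_def polys_upto_def by (auto intro: fun_vs.span_base)
qed

lemma polys_add:
  assumes "f \<in> polys V" "g \<in> polys V" shows "(\<lambda>t. f t + g t) \<in> polys V"
proof -
  obtain d d' where "f \<in> polys_upto V d" "g \<in> polys_upto V d'"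
    using assms by (auto simp: polys_def)
  then have "f \<in> polys_upto V (d + d')" "g \<in> polys_upto V (d + d')"
    using polys_upto_mono[of d "d + d'" V] polys_upto_mono[of d' "d + d'" V] by auto
  then show ?thesis unfolding polys_def using polys_upto_add by blast
qed

lemma polys_mult: "f \<in> polys V \<Longrightarrow> g \<in> polys V \<Longrightarrow> (\<lambda>t. f t * g t) \<in> polys V"
  unfolding polys_def using polys_upto_mult by blast

lemma polys_minus: "f \<in> polys V \<Longrightarrow> (\<lambda>t. - f t) \<in> polys V"
  using polys_mult[OF polys_const[of "-1"]] by simp

lemma polys_diff: "f \<in> polys V \<Longrightarrow> g \<in> polys V \<Longrightarrow> (\<lambda>t. f t - g t) \<in> polys V"
  using polys_add[OF _ polys_minus] by simp

lemma polys_sum: "(\<And>x. x \<in> A \<Longrightarrow> f x \<in> polys V) \<Longrightarrow> (\<lambda>t. \<Sum>x\<in>A. f x t) \<in> polys V"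
  by (induction A rule: infinite_finite_induct) (auto intro: polys_const polys_add)

section \<open>Algebraic relations among too many polynomials\<close>

lemma digits_unique:
  fixes e e' :: "nat \<Rightarrow> nat"
  assumes "(\<Sum>i<n. e i * D ^ i) = (\<Sum>i<n. e' i * D ^ i)"
    and "\<And>i. i < n \<Longrightarrow> e i < D" "\<And>i. i < n \<Longrightarrow> e' i < D"
  shows "\<forall>i<n. e i = e' i"
  using assms
proof (induction n arbitrary: e e')
  case (Suc n)
  have *: "(\<Sum>i<Suc n. f i * D ^ i) = f 0 + D * (\<Sum>i<n. f (Suc i) * D ^ i)" for f :: "nat \<Rightarrow> nat"
    by (subst sum.lessThan_Suc_shift) (simp add: sum_distrib_left algebra_simps)
  have lt: "e 0 < D" "e' 0 < D" using Suc.prems by auto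
  have eq: "e 0 + D * (\<Sum>i<n. e (Suc i) * D ^ i) = e' 0 + D * (\<Sum>i<n. e' (Suc i) * D ^ i)"
    using Suc.prems(1) unfolding * .
  have "e 0 = e' 0" using arg_cong[OF eq, of "\<lambda>x. x mod D"] lt by simp
  moreover have "(\<Sum>i<n. e (Suc i) * D ^ i) = (\<Sum>i<n. e' (Suc i) * D ^ i)"
    using eq calculation lt by simp
  then have "\<forall>i<n. e (Suc i) = e' (Suc i)"
    using Suc.prems(2,3) by (intro Suc.IH) auto
  ultimately show ?case by (auto simp: less_Suc_eq_0_disj)
qed simp

text \<open>Stated for families because distinct exponents may yield the same function. A repetition
  gives the relation with coefficients 1 and -1; otherwise the image is a set too large to be
  independent in the span.\<close>

lemma (in vector_space) dependent_family:
  assumes "finite A" "finite S" "card S < card A" "\<And>x. x \<in> A \<Longrightarrow> f x \<in> span S"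
  obtains c where "\<exists>x\<in>A. c x \<noteq> 0" "(\<Sum>x\<in>A. scale (c x) (f x)) = 0"
proof (cases "inj_on f A")
  case False
  then obtain x y where xy: "x \<in> A" "y \<in> A" "x \<noteq> y" "f x = f y" by (auto simp: inj_on_def)
  define c :: "_ \<Rightarrow> 'a" where "c z = (if z = x then 1 else if z = y then - 1 else 0)" for z
  have "(\<Sum>z\<in>A. scale (c z) (f z)) = (\<Sum>z\<in>{x,y}. scale (c z) (f z))"
    using xy assms(1) by (intro sum.mono_neutral_right) (auto simp: c_def)
  also have "\<dots> = 0" using xy by (simp add: c_def)
  finally show ?thesis using xy by (intro that[of c]) (auto simp: c_def)
next
  case True
  have "dependent (f ` A)"
  proof (rule ccontr)
    assume "independent (f ` A)"
    then have "card (f ` A) \<le> card S"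
      using independent_span_bound[OF assms(2)] assms(4) by blast
    then show False using assms(3) card_image[OF True] by simp
  qed
  then obtain u where u: "\<exists>v\<in>f ` A. u v \<noteq> 0" "(\<Sum>v\<in>f ` A. scale (u v) v) = 0"
    using dependent_finite[OF finite_imageI[OF assms(1)]] by auto
  show ?thesis
    using u by (intro that[of "\<lambda>x. u (f x)"]) (auto simp: sum.reindex[OF True])
qed

text \<open>Too few parameters force an algebraic relation among the coordinates of a polynomial map,
  with exponents below \<open>D\<close>. On the curve below the monomials occurring in such a relation
  become distinct powers of \<open>z\<close>.\<close>

lemma finite_curve_inter_polynomial_image:
  fixes \<Phi> :: "('i \<Rightarrow> 'k::field) \<Rightarrow> 't \<Rightarrow> 'k"
  assumes T: "finite T" and V: "finite V" "card V < card T"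
    and \<Phi>: "\<And>\<tau>. \<tau> \<in> T \<Longrightarrow> (\<lambda>t. \<Phi> t \<tau>) \<in> polys_upto V d"
    and idx: "bij_betw idx T {..<card T}"
    and D: "D > (card T * d + 1) ^ card T"
  shows "finite {z. \<exists>t. \<forall>\<tau>\<in>T. \<Phi> t \<tau> = z ^ (D ^ idx \<tau>)}"
proof -
  define n where "n = card T"
  define A where "A = (\<Pi>\<^sub>E \<tau>\<in>T. {..<D})"
  \<comment> \<open>Each coordinate has degree at most d in every variable, so a product of powers
    below D of all n coordinates has degree at most n D d.\<close>
  define N where "N = n * D * d"
  have D1: "D \<ge> 1" using D by (simp add: Suc_le_eq)
  have finA: "finite A" unfolding A_def using T by (intro finite_PiE) auto
  have cardA: "card A = D ^ n" unfolding A_def n_def using T by (simp add: card_PiE)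
  define M where "M = (\<lambda>e t. \<Prod>\<tau>\<in>T. \<Phi> t \<tau> ^ e \<tau>)"
  have M: "M e \<in> fun_vs.span (monomials V N)" if "e \<in> A" for e
  proof -
    have "M e \<in> polys_upto V (\<Sum>\<tau>\<in>T. e \<tau> * d)"
      unfolding M_def by (intro polys_upto_prod polys_upto_power \<Phi> T)
    moreover have "(\<Sum>\<tau>\<in>T. e \<tau> * d) \<le> (\<Sum>\<tau>\<in>T. D * d)"
      using that by (intro sum_mono mult_right_mono) (force simp: A_def PiE_iff)+
    then have "(\<Sum>\<tau>\<in>T. e \<tau> * d) \<le> N" by (simp add: N_def n_def algebra_simps)
    ultimately show ?thesis using polys_upto_mono unfolding polys_upto_def by blast
  qed
  have "card (monomials V N :: (('i \<Rightarrow> 'k) \<Rightarrow> 'k) set) \<le> (N + 1) ^ card V"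
    using V by (intro card_monomials_le)
  \<comment> \<open>Pulling D out of N + 1 leaves \<open>D ^ card V\<close> times a factor free of
    D. The choice of D exceeds that factor, and since card V < n the one spare power of D in
    \<open>D ^ n\<close> absorbs it.\<close>
  also have "\<dots> \<le> (D * (n * d + 1)) ^ card V"
    using D1 by (intro power_mono) (auto simp: N_def algebra_simps)
  also have "\<dots> = D ^ card V * (n * d + 1) ^ card V" by (rule power_mult_distrib)
  also have "\<dots> \<le> D ^ card V * (n * d + 1) ^ n"
    using V by (intro mult_left_mono power_increasing) (auto simp: n_def)
  also have "\<dots> < D ^ card V * D"
    using D D1 by (intro mult_strict_left_mono) (auto simp: n_def)
  also have "\<dots> = D ^ Suc (card V)" by simp
  also have "\<dots> \<le> D ^ n" using V D1 by (intro power_increasing) (auto simp: n_def)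
  finally have "card (monomials V N :: (('i \<Rightarrow> 'k) \<Rightarrow> 'k) set) < card A" using cardA by simp
  then obtain c where c: "\<exists>e\<in>A. c e \<noteq> 0" "(\<Sum>e\<in>A. fun_scale (c e) (M e)) = 0"
    using fun_vs.dependent_family[of A "monomials V N" M] M finA finite_monomials[OF V(1)] by metis
  \<comment> \<open>On the curve \<open>M e\<close> takes the value \<open>z ^ k e\<close>. The
    exponents in e are the base D digits of \<open>k e\<close>.\<close>
  define k where "k = (\<lambda>e. \<Sum>\<tau>\<in>T. e \<tau> * D ^ idx \<tau>)"
  have k: "inj_on k A"
  proof (rule inj_onI)
    fix e e' assume ee: "e \<in> A" "e' \<in> A" "k e = k e'"
    define g where "g = inv_into T idx"
    have g: "bij_betw g {..<n} T" unfolding g_def n_def using idx by (rule bij_betw_inv_into)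
    have ig: "idx (g i) = i" if "i < n" for i
      unfolding g_def using idx that by (simp add: bij_betw_inv_into_right n_def)
    have "k e = (\<Sum>i<n. e (g i) * D ^ i)" for e
      unfolding k_def using ig by (subst sum.reindex_bij_betw[OF g, symmetric]) auto
    then have "(\<Sum>i<n. e (g i) * D ^ i) = (\<Sum>i<n. e' (g i) * D ^ i)" using ee by simp
    moreover have "g i \<in> T" if "i < n" for i using g that by (auto simp: bij_betw_def)
    ultimately have "\<forall>i<n. e (g i) = e' (g i)"
      using ee(1,2) by (intro digits_unique) (auto simp: A_def PiE_iff)
    moreover have "idx \<tau> < n" "g (idx \<tau>) = \<tau>" if "\<tau> \<in> T" for \<tau>
      using idx that bij_betwE[OF idx] by (auto simp: g_def n_def bij_betw_inv_into_left)
    ultimately have "\<And>\<tau>. \<tau> \<in> T \<Longrightarrow> e \<tau> = e' \<tau>" by metis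
    then show "e = e'" using ee(1,2) unfolding A_def by (intro PiE_ext)
  qed
  define P where "P = (\<Sum>e\<in>A. monom (c e) (k e))"
  have "P \<noteq> 0"
  proof -
    obtain e0 where e0: "e0 \<in> A" "c e0 \<noteq> 0" using c by blast
    have "coeff P (k e0) = (\<Sum>e\<in>A. if e = e0 then c e0 else 0)"
      unfolding P_def coeff_sum
      using e0 k by (intro sum.cong) (auto dest: inj_onD)
    then show ?thesis using e0 finA by auto
  qed
  then have roots: "finite {z. poly P z = 0}" by (rule poly_roots_finite)
  have zero: "poly P z = 0" if "\<forall>\<tau>\<in>T. \<Phi> t \<tau> = z ^ (D ^ idx \<tau>)" for z t
  proof -
    have "M e t = z ^ k e" for e
      unfolding M_def k_def power_sum
    proof (rule prod.cong[OF refl])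
      fix \<tau> assume "\<tau> \<in> T"
      then have "\<Phi> t \<tau> = z ^ (D ^ idx \<tau>)" using that by blast
      then show "\<Phi> t \<tau> ^ e \<tau> = z ^ (e \<tau> * D ^ idx \<tau>)"
        by (simp only: power_mult[symmetric] mult.commute[of "e \<tau>"])
    qed
    then have "poly P z = (\<Sum>e\<in>A. fun_scale (c e) (M e) t)"
      by (simp add: P_def poly_sum poly_monom fun_scale_def)
    also have "\<dots> = 0" using fun_cong[OF c(2), of t] by (simp add: sum_fun_apply)
    finally show ?thesis .
  qed
  have "{z. \<exists>t. \<forall>\<tau>\<in>T. \<Phi> t \<tau> = z ^ (D ^ idx \<tau>)} \<subseteq> {z. poly P z = 0}"
    by (intro Collect_mono impI) (erule exE, rule zero)
  then show ?thesis using roots by (rule finite_subset)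
qed

text \<open>With a common degree bound one curve serves for all j. Each image excludes finitely many
  z, and a field of characteristic zero is infinite, so some point of the curve avoids every
  image.\<close>

lemma polynomial_images_not_covering:
  fixes \<Phi> :: "'j \<Rightarrow> ('i \<Rightarrow> 'k::field_char_0) \<Rightarrow> 't \<Rightarrow> 'k"
  assumes J: "finite J" and T: "finite T"
    and V: "\<And>j. j \<in> J \<Longrightarrow> finite (V j)" "\<And>j. j \<in> J \<Longrightarrow> card (V j) < card T"
    and \<Phi>: "\<And>j \<tau>. j \<in> J \<Longrightarrow> \<tau> \<in> T \<Longrightarrow> (\<lambda>t. \<Phi> j t \<tau>) \<in> polys (V j)"
  obtains x where "\<And>j t. j \<in> J \<Longrightarrow> \<exists>\<tau>\<in>T. \<Phi> j t \<tau> \<noteq> x \<tau>"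
proof -
  have "\<exists>d. \<forall>p\<in>J \<times> T. (\<lambda>t. \<Phi> (fst p) t (snd p)) \<in> polys_upto (V (fst p)) d"
  proof -
    have "\<forall>p\<in>J \<times> T. \<exists>d. (\<lambda>t. \<Phi> (fst p) t (snd p)) \<in> polys_upto (V (fst p)) d"
      using \<Phi> unfolding polys_def by auto
    then obtain d where d: "\<forall>p\<in>J \<times> T. (\<lambda>t. \<Phi> (fst p) t (snd p)) \<in> polys_upto (V (fst p)) (d p)"
      by metis
    have "d p \<le> (\<Sum>p\<in>J \<times> T. d p)" if "p \<in> J \<times> T" for p
      using that J T by (intro member_le_sum) auto
    then show ?thesis using d polys_upto_mono by blast
  qed
  then obtain d where d: "\<And>j \<tau>. j \<in> J \<Longrightarrow> \<tau> \<in> T \<Longrightarrow> (\<lambda>t. \<Phi> j t \<tau>) \<in> polys_upto (V j) d"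
    by auto
  obtain idx where idx: "bij_betw idx T {..<card T}"
    using ex_bij_betw_finite_nat[OF T] by (auto simp: atLeast0LessThan)
  define D where "D = (card T * d + 1) ^ card T + 1"
  let ?B = "\<Union>j\<in>J. {z. \<exists>t. \<forall>\<tau>\<in>T. \<Phi> j t \<tau> = z ^ (D ^ idx \<tau>)}"
  have "finite ?B"
  proof (rule finite_UN_I[OF J])
    fix j assume j: "j \<in> J"
    show "finite {z. \<exists>t. \<forall>\<tau>\<in>T. \<Phi> j t \<tau> = z ^ (D ^ idx \<tau>)}"
      by (rule finite_curve_inter_polynomial_image[OF T V(1)[OF j] V(2)[OF j] d[OF j] idx])
        (auto simp: D_def)
  qed
  then obtain z where z: "z \<notin> ?B"
    using ex_new_if_finite[OF infinite_UNIV_char_0] by blast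
  have "\<exists>\<tau>\<in>T. \<Phi> j t \<tau> \<noteq> z ^ (D ^ idx \<tau>)" if "j \<in> J" for j t
  proof (rule ccontr)
    assume "\<not> ?thesis"
    then have "\<forall>\<tau>\<in>T. \<Phi> j t \<tau> = z ^ (D ^ idx \<tau>)" by simp
    then have "z \<in> ?B" by (intro UN_I[OF that] CollectI exI)
    then show False using z by contradiction
  qed
  then show ?thesis by (rule that[of "\<lambda>\<tau>. z ^ (D ^ idx \<tau>)"])
qed

section \<open>Reduced bases and skew forms\<close>

text \<open>Reduced echelon form with pivots L, found as a maximal set of coordinates with a dual
  family in U: a vector that the family fails to expand leaves a remainder vanishing on L, and a
  nonzero coordinate of it is a further pivot. The basis is determined by its entries outside L, so
  a subspace costs card L (card E - card L) parameters.\<close>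

lemma reduced_basis:
  fixes U :: "('i \<Rightarrow> 'k::field) set"
  assumes E: "finite E" and U: "fun_vs.subspace U"
    and supp: "\<And>u e. u \<in> U \<Longrightarrow> e \<notin> E \<Longrightarrow> u e = 0"
  obtains L \<alpha> where "L \<subseteq> E" "\<And>l. l \<in> L \<Longrightarrow> \<alpha> l \<in> U"
    "\<And>l l'. l \<in> L \<Longrightarrow> l' \<in> L \<Longrightarrow> \<alpha> l l' = (if l = l' then 1 else 0)"
    "\<And>u e. u \<in> U \<Longrightarrow> u e = (\<Sum>l\<in>L. u l * \<alpha> l e)"
proof -
  define dual where "dual L \<alpha> \<longleftrightarrow> L \<subseteq> E \<and>
    (\<forall>l\<in>L. \<alpha> l \<in> U \<and> (\<forall>l'\<in>L. \<alpha> l l' = (if l = l' then 1 else 0)))"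
    for L and \<alpha> :: "'i \<Rightarrow> 'i \<Rightarrow> 'k"
  let ?\<L> = "{L. \<exists>\<alpha>. dual L \<alpha>}"
  have "?\<L> \<subseteq> Pow E" by (auto simp: dual_def)
  then have "finite ?\<L>" using E finite_subset by auto
  moreover have "{} \<in> ?\<L>" by (auto simp: dual_def)
  ultimately obtain L where L: "L \<in> ?\<L>" "\<And>L'. L' \<in> ?\<L> \<Longrightarrow> L \<subseteq> L' \<Longrightarrow> L = L'"
    using finite_has_maximal[of ?\<L>] by blast
  then obtain \<alpha> where \<alpha>: "dual L \<alpha>" by blast
  have finL: "finite L" using \<alpha> E finite_subset by (auto simp: dual_def)
  have "u e = (\<Sum>l\<in>L. u l * \<alpha> l e)" if u: "u \<in> U" for u e
  proof (rule ccontr)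
    assume ne: "u e \<noteq> (\<Sum>l\<in>L. u l * \<alpha> l e)"
    define w where "w = u - (\<Sum>l\<in>L. fun_scale (u l) (\<alpha> l))"
    have w: "w x = u x - (\<Sum>l\<in>L. u l * \<alpha> l x)" for x
      by (simp add: w_def sum_fun_apply fun_scale_def)
    have wU: "w \<in> U" unfolding w_def using \<alpha> u
      by (intro fun_vs.subspace_diff fun_vs.subspace_sum fun_vs.subspace_scale U) (auto simp: dual_def)
    have we: "w e \<noteq> 0" using ne by (simp add: w)
    have wL: "w l' = 0" if "l' \<in> L" for l'
    proof -
      have "(\<Sum>l\<in>L. u l * \<alpha> l l') = (\<Sum>l\<in>L. if l = l' then u l' else 0)"
        using \<alpha> that by (intro sum.cong) (auto simp: dual_def)
      then show ?thesis using that finL by (simp add: w)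
    qed
    have e: "e \<in> E" "e \<notin> L" using we wL supp[OF wU] by auto
    \<comment> \<open>Normalize w at e and clear the coordinate e of the old vectors; since w
      vanishes on L, duality there is preserved.\<close>
    define \<beta> where "\<beta> l = (if l = e then fun_scale (1 / w e) w
      else \<alpha> l - fun_scale (\<alpha> l e / w e) w)" for l
    have "dual (insert e L) \<beta>"
      unfolding dual_def
    proof (intro conjI ballI)
      show "insert e L \<subseteq> E" using e \<alpha> by (auto simp: dual_def)
    next
      fix l assume l: "l \<in> insert e L"
      then show "\<beta> l \<in> U"
        using \<alpha> wU by (auto simp: \<beta>_def dual_def intro!: fun_vs.subspace_diff fun_vs.subspace_scale U)
      fix l' assume "l' \<in> insert e L"
      then show "\<beta> l l' = (if l = l' then 1 else 0)"
        using l e we wL \<alpha> by (auto simp: \<beta>_def dual_def fun_scale_def)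
    qed
    then have "insert e L \<in> ?\<L>" by blast
    then show False using L(2)[of "insert e L"] e by auto
  qed
  note expand = this
  show ?thesis
  proof (rule that[of L \<alpha>])
    show "u e = (\<Sum>l\<in>L. u l * \<alpha> l e)" if "u \<in> U" for u e using that by (rule expand)
  next
    show "L \<subseteq> E" using \<alpha> unfolding dual_def by (rule conjunct1)
  next
    show "\<alpha> l \<in> U" if "l \<in> L" for l
      using \<alpha> that unfolding dual_def by blast
  next
    show "\<alpha> l l' = (if l = l' then 1 else 0)" if "l \<in> L" "l' \<in> L" for l l'
      using \<alpha> that unfolding dual_def by blast
  qed
qed

text \<open>A dual family is independent: evaluating a relation at l' isolates one coefficient. This
  bounds the number of pivots by the number of rows spanning the space.\<close>

lemma card_dual_family_le:
  fixes \<alpha> :: "'i \<Rightarrow> 'i \<Rightarrow> 'k::field"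
  assumes L: "finite L" and S: "finite S"
    and span: "\<And>l. l \<in> L \<Longrightarrow> \<alpha> l \<in> fun_vs.span S"
    and dual: "\<And>l l'. l \<in> L \<Longrightarrow> l' \<in> L \<Longrightarrow> \<alpha> l l' = (if l = l' then 1 else 0)"
  shows "card L \<le> card S"
proof (rule ccontr)
  assume "\<not> ?thesis"
  then have "card S < card L" by simp
  then obtain c where c0: "\<exists>l\<in>L. c l \<noteq> 0" and c: "(\<Sum>l\<in>L. fun_scale (c l) (\<alpha> l)) = 0"
    by (rule fun_vs.dependent_family[OF L S _ span])
  obtain l' where l': "l' \<in> L" "c l' \<noteq> 0" using c0 by blast
  have "0 = (\<Sum>l\<in>L. c l * \<alpha> l l')"
    using fun_cong[OF c, of l'] by (simp add: sum_fun_apply fun_scale_def)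
  also have "\<dots> = (\<Sum>l\<in>L. if l = l' then c l' else 0)"
    using dual l'(1) by (intro sum.cong) auto
  finally show False using l' L by simp
qed

lemma sum_mult_delta:
  fixes f :: "'i \<Rightarrow> 'k::semiring_1"
  assumes "finite I" "k \<in> I" "\<And>i. i \<in> I \<Longrightarrow> d i = (if i = k then 1 else 0)"
  shows "(\<Sum>i\<in>I. f i * d i) = f k" "(\<Sum>i\<in>I. d i * f i) = f k"
proof -
  have "(\<Sum>i\<in>I. f i * d i) = (\<Sum>i\<in>I. if i = k then f k else 0)"
    "(\<Sum>i\<in>I. d i * f i) = (\<Sum>i\<in>I. if i = k then f k else 0)"
    by (rule sum.cong; simp add: assms(3))+
  then show "(\<Sum>i\<in>I. f i * d i) = f k" "(\<Sum>i\<in>I. d i * f i) = f k" using assms(1,2) by simp_all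
qed

text \<open>A reduced basis of the row space of \<Omega>, with pivots I, expands the rows, and by
  skewness it also expands the columns; so \<Omega> factors through its restriction N to I. Writing
  the basis vectors as combinations of rows gives a left inverse M of N. The negative transpose of M
  is then a right inverse by skewness of N, and equality of the two makes M skew.\<close>

lemma skew_form_decomposition:
  fixes \<Omega> :: "'i \<Rightarrow> 'i \<Rightarrow> 'k::field"
  assumes R: "finite R" and skew: "\<And>p q. \<Omega> p q = - \<Omega> q p"
    and supp: "\<And>p q. \<Omega> p q \<noteq> 0 \<Longrightarrow> p \<in> R"
  obtains I C M where "I \<subseteq> R"
    "\<And>p \<kappa>. p \<in> I \<Longrightarrow> \<kappa> \<in> I \<Longrightarrow> C p \<kappa> = (if p = \<kappa> then 1 else 0)"
    "\<And>p q. \<Omega> p q = (\<Sum>\<iota>\<in>I. \<Sum>\<kappa>\<in>I. C p \<iota> * \<Omega> \<iota> \<kappa> * C q \<kappa>)"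
    "\<And>\<iota> \<kappa>. \<iota> \<in> I \<Longrightarrow> \<kappa> \<in> I \<Longrightarrow> M \<iota> \<kappa> = - M \<kappa> \<iota>"
    "\<And>\<iota> \<nu>. \<iota> \<in> I \<Longrightarrow> \<nu> \<in> I \<Longrightarrow> (\<Sum>\<kappa>\<in>I. \<Omega> \<iota> \<kappa> * M \<kappa> \<nu>) = (if \<iota> = \<nu> then 1 else 0)"
proof -
  define U where "U = range (\<lambda>x q. \<Sum>p\<in>R. x p * \<Omega> p q)"
  have supp': "\<Omega> p q = 0" if "p \<notin> R \<or> q \<notin> R" for p q
    using supp[of p q] supp[of q p] skew[of p q] that by auto
  have U: "fun_vs.subspace U"
    unfolding fun_vs.subspace_def
  proof (intro conjI ballI allI)
    show "0 \<in> U" unfolding U_def by (rule image_eqI[of _ _ "\<lambda>_. 0"]) (auto simp: zero_fun_def)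
  next
    fix u w assume "u \<in> U" "w \<in> U"
    then obtain x y where "u = (\<lambda>q. \<Sum>p\<in>R. x p * \<Omega> p q)" "w = (\<lambda>q. \<Sum>p\<in>R. y p * \<Omega> p q)"
      by (auto simp: U_def)
    then show "u + w \<in> U" unfolding U_def
      by (intro image_eqI[of _ _ "\<lambda>p. x p + y p"]) (auto simp: plus_fun_def sum.distrib algebra_simps)
  next
    fix u c assume "u \<in> U"
    then obtain x where "u = (\<lambda>q. \<Sum>p\<in>R. x p * \<Omega> p q)" by (auto simp: U_def)
    then show "fun_scale c u \<in> U" unfolding U_def
      by (intro image_eqI[of _ _ "\<lambda>p. c * x p"]) (auto simp: fun_scale_def sum_distrib_left algebra_simps)
  qed
  obtain I \<alpha> where I: "I \<subseteq> R" and \<alpha>U: "\<And>\<iota>. \<iota> \<in> I \<Longrightarrow> \<alpha> \<iota> \<in> U"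
    and dual: "\<And>\<iota> \<kappa>. \<iota> \<in> I \<Longrightarrow> \<kappa> \<in> I \<Longrightarrow> \<alpha> \<iota> \<kappa> = (if \<iota> = \<kappa> then 1 else 0)"
    and expand: "\<And>u e. u \<in> U \<Longrightarrow> u e = (\<Sum>\<iota>\<in>I. u \<iota> * \<alpha> \<iota> e)"
    by (rule reduced_basis[OF R U]) (auto simp: U_def supp')
  have finI: "finite I" using I R finite_subset by blast
  have row: "\<Omega> p q = (\<Sum>\<iota>\<in>I. \<Omega> p \<iota> * \<alpha> \<iota> q)" for p q
  proof (cases "p \<in> R")
    case True
    have "\<Omega> p \<in> U" unfolding U_def
      using True R by (intro image_eqI[of _ _ "\<lambda>p'. if p' = p then 1 else 0"]) (auto simp: if_distrib[of "\<lambda>x. x * _"] cong: if_cong)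
    then show ?thesis by (rule expand)
  qed (simp add: supp')
  have col: "\<Omega> p \<iota> = (\<Sum>\<kappa>\<in>I. \<alpha> \<kappa> p * \<Omega> \<kappa> \<iota>)" for p \<iota>
  proof -
    have "\<Omega> p \<iota> = (\<Sum>\<kappa>\<in>I. - \<Omega> \<iota> \<kappa> * \<alpha> \<kappa> p)"
      using row[of \<iota> p] skew[of p \<iota>] by (simp add: sum_negf)
    also have "\<dots> = (\<Sum>\<kappa>\<in>I. \<alpha> \<kappa> p * \<Omega> \<kappa> \<iota>)"
      by (intro sum.cong refl) (metis skew mult.commute)
    finally show ?thesis .
  qed
  have dec: "\<Omega> p q = (\<Sum>\<iota>\<in>I. \<Sum>\<kappa>\<in>I. \<alpha> \<iota> p * \<Omega> \<iota> \<kappa> * \<alpha> \<kappa> q)" for p q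
  proof -
    have "\<Omega> p q = (\<Sum>\<kappa>\<in>I. (\<Sum>\<iota>\<in>I. \<alpha> \<iota> p * \<Omega> \<iota> \<kappa>) * \<alpha> \<kappa> q)"
      using row[of p q] by (simp flip: col)
    also have "\<dots> = (\<Sum>\<kappa>\<in>I. \<Sum>\<iota>\<in>I. \<alpha> \<iota> p * \<Omega> \<iota> \<kappa> * \<alpha> \<kappa> q)" by (simp add: sum_distrib_right)
    also have "\<dots> = (\<Sum>\<iota>\<in>I. \<Sum>\<kappa>\<in>I. \<alpha> \<iota> p * \<Omega> \<iota> \<kappa> * \<alpha> \<kappa> q)" by (rule sum.swap)
    finally show ?thesis .
  qed
  have "\<forall>\<iota>\<in>I. \<exists>x. \<alpha> \<iota> = (\<lambda>q. \<Sum>p\<in>R. x p * \<Omega> p q)" using \<alpha>U by (auto simp: U_def)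
  then obtain x where x: "\<And>\<iota>. \<iota> \<in> I \<Longrightarrow> \<alpha> \<iota> = (\<lambda>q. \<Sum>p\<in>R. x \<iota> p * \<Omega> p q)" by metis
  define M where "M \<iota> \<kappa> = (\<Sum>p\<in>R. x \<iota> p * \<alpha> \<kappa> p)" for \<iota> \<kappa>
  have left: "(\<Sum>\<kappa>\<in>I. M \<iota> \<kappa> * \<Omega> \<kappa> \<nu>) = (if \<iota> = \<nu> then 1 else 0)" if "\<iota> \<in> I" "\<nu> \<in> I" for \<iota> \<nu>
  proof -
    have "(\<Sum>\<kappa>\<in>I. M \<iota> \<kappa> * \<Omega> \<kappa> \<nu>) = (\<Sum>\<kappa>\<in>I. \<Sum>p\<in>R. x \<iota> p * (\<alpha> \<kappa> p * \<Omega> \<kappa> \<nu>))"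
      by (simp add: M_def sum_distrib_right mult.assoc)
    also have "\<dots> = (\<Sum>p\<in>R. x \<iota> p * (\<Sum>\<kappa>\<in>I. \<alpha> \<kappa> p * \<Omega> \<kappa> \<nu>))"
      by (subst sum.swap) (simp add: sum_distrib_left)
    also have "\<dots> = (\<Sum>p\<in>R. x \<iota> p * \<Omega> p \<nu>)" by (simp flip: col)
    also have "\<dots> = \<alpha> \<iota> \<nu>" using x[OF that(1)] by simp
    finally show ?thesis using dual that by simp
  qed
  have right: "(\<Sum>\<mu>\<in>I. \<Omega> \<kappa> \<mu> * - M \<nu> \<mu>) = (if \<kappa> = \<nu> then 1 else 0)" if "\<kappa> \<in> I" "\<nu> \<in> I" for \<kappa> \<nu>
  proof -
    have "(\<Sum>\<mu>\<in>I. \<Omega> \<kappa> \<mu> * - M \<nu> \<mu>) = (\<Sum>\<mu>\<in>I. M \<nu> \<mu> * \<Omega> \<mu> \<kappa>)"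
      by (intro sum.cong refl) (metis skew minus_mult_commute mult.commute)
    then show ?thesis using left[OF that(2,1)] by auto
  qed
  have skewM: "M \<iota> \<nu> = - M \<nu> \<iota>" if "\<iota> \<in> I" "\<nu> \<in> I" for \<iota> \<nu>
  proof -
    have "M \<iota> \<nu> = (\<Sum>\<kappa>\<in>I. M \<iota> \<kappa> * (\<Sum>\<mu>\<in>I. \<Omega> \<kappa> \<mu> * - M \<nu> \<mu>))"
      using that by (intro sum_mult_delta(1)[symmetric] finI right)
    also have "\<dots> = (\<Sum>\<kappa>\<in>I. \<Sum>\<mu>\<in>I. M \<iota> \<kappa> * \<Omega> \<kappa> \<mu> * - M \<nu> \<mu>)"
      by (simp add: sum_distrib_left mult.assoc)
    also have "\<dots> = (\<Sum>\<mu>\<in>I. (\<Sum>\<kappa>\<in>I. M \<iota> \<kappa> * \<Omega> \<kappa> \<mu>) * - M \<nu> \<mu>)"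
      by (subst sum.swap) (simp add: sum_distrib_right sum_negf)
    also have "\<dots> = - M \<nu> \<iota>"
      using that by (intro sum_mult_delta(2) finI) (auto simp: left)
    finally show ?thesis .
  qed
  show ?thesis
  proof (rule that[of I "\<lambda>p \<iota>. \<alpha> \<iota> p" M])
    show "(\<Sum>\<kappa>\<in>I. \<Omega> \<iota> \<kappa> * M \<kappa> \<nu>) = (if \<iota> = \<nu> then 1 else 0)"
      if "\<iota> \<in> I" "\<nu> \<in> I" for \<iota> \<nu>
    proof -
      have "(\<Sum>\<kappa>\<in>I. \<Omega> \<iota> \<kappa> * M \<kappa> \<nu>) = (\<Sum>\<kappa>\<in>I. \<Omega> \<iota> \<kappa> * - M \<nu> \<kappa>)"
        using that(2) by (intro sum.cong refl arg_cong2[where f = "(*)"] skewM)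
      then show ?thesis using right[OF that] by simp
    qed
    show "\<alpha> \<kappa> p = (if p = \<kappa> then 1 else 0)" if "p \<in> I" "\<kappa> \<in> I" for p \<kappa>
      using dual[OF that(2,1)] by auto
  qed (fact I dec skewM)+
qed

section \<open>Parametrization of the pairs annihilated by a skew form\<close>

text \<open>One type indexes both the parameters and the entries of a pair. As a target,
  \<open>F_coord i e\<close> is an entry of F. As a parameter it is that entry for e outside
  \<open>I \<times> {..<2}\<close>, and the value at the pivot e of the i-th scaled paired row for e
  in L. The parameter \<open>G_coord j e\<close> is an entry of G outside
  \<open>I \<times> {..<2}\<close> and an entry of the product of G with C inside.\<close>

datatype coord =
    C_coord nat nat
  | M_coord nat nat
  | A_coord "nat \<times> nat" "nat \<times> nat"
  | F_coord nat "nat \<times> nat"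
  | G_coord nat "nat \<times> nat"

definition skew_entry :: "nat \<times> nat \<Rightarrow> (coord \<Rightarrow> 'k::field) \<Rightarrow> nat \<Rightarrow> nat \<Rightarrow> 'k" where
  "skew_entry uv t \<kappa> \<nu> =
     (if \<kappa> < \<nu> then (if (\<kappa>, \<nu>) = uv then 1 else t (M_coord \<kappa> \<nu>))
      else if \<nu> < \<kappa> then - (if (\<nu>, \<kappa>) = uv then 1 else t (M_coord \<nu> \<kappa>)) else 0)"

text \<open>The values of a vector at the pivots are its coefficients in the reduced basis, so they
  determine the remaining entries.\<close>

definition row_entry :: "(nat \<times> nat) set \<Rightarrow> (coord \<Rightarrow> 'k::field) \<Rightarrow> nat \<Rightarrow> nat \<times> nat \<Rightarrow> 'k" where
  "row_entry L t i e =
     (if e \<in> L then t (F_coord i e) else \<Sum>l\<in>L. t (F_coord i l) * t (A_coord l e))"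

text \<open>As C is the identity on I, subtracting the sum over p outside I turns an entry of F C or
  G C back into one of F or G. The entry of F C is a paired row times M; at a pivot the entry of G C
  is dictated by orthogonality to the basis vector of that pivot.\<close>

fun bad_param :: "nat \<Rightarrow> nat set \<Rightarrow> (nat \<times> nat) set \<Rightarrow> nat \<times> nat \<Rightarrow> (coord \<Rightarrow> 'k::field) \<Rightarrow> coord \<Rightarrow> 'k" where
  "bad_param r I L uv t (F_coord i (q, c)) =
     (if q \<in> I then (\<Sum>\<kappa>\<in>I. row_entry L t i (\<kappa>, c) * skew_entry uv t \<kappa> q)
        - (\<Sum>p\<in>{..<r} - I. t (C_coord p q) * t (F_coord i (p, c)))
      else t (F_coord i (q, c)))"
| "bad_param r I L uv t (G_coord j (q, c)) =
     (if q \<in> I then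
        (if (q, c) \<in> L then - (\<Sum>m\<in>I \<times> {..<2} - L. t (A_coord (q, c) m) * t (G_coord j m))
         else t (G_coord j (q, c)))
        - (\<Sum>p\<in>{..<r} - I. t (C_coord p q) * t (G_coord j (p, c)))
      else t (G_coord j (q, c)))"
| "bad_param r I L uv t _ = 0"

definition bad_coords :: "nat \<Rightarrow> nat \<Rightarrow> nat \<Rightarrow> nat set \<Rightarrow> (nat \<times> nat) set \<Rightarrow> nat \<times> nat \<Rightarrow> coord set" where
  "bad_coords r a b I L uv =
     case_prod C_coord ` (({..<r} - I) \<times> I) \<union>
     case_prod M_coord ` ({(\<kappa>, \<nu>) \<in> I \<times> I. \<kappa> < \<nu>} - {uv}) \<union>
     case_prod A_coord ` (L \<times> (I \<times> {..<2} - L)) \<union>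
     case_prod F_coord ` ({..<a} \<times> (L \<union> ({..<r} - I) \<times> {..<2})) \<union>
     case_prod G_coord ` ({..<b} \<times> ({..<r} \<times> {..<2} - L))"

definition pair_coords :: "nat \<Rightarrow> nat \<Rightarrow> nat \<Rightarrow> coord set" where
  "pair_coords r a b =
     case_prod F_coord ` ({..<a} \<times> ({..<r} \<times> {..<2})) \<union>
     case_prod G_coord ` ({..<b} \<times> ({..<r} \<times> {..<2}))"

lemma finite_bad_coords:
  "I \<subseteq> {..<r} \<Longrightarrow> L \<subseteq> I \<times> {..<2} \<Longrightarrow> finite (bad_coords r a b I L uv)"
proof -
  assume I: "I \<subseteq> {..<r}" and L: "L \<subseteq> I \<times> {..<2}"
  have fI: "finite I" using I by (rule finite_subset) simp
  have fL: "finite L" using L by (rule finite_subset) (simp add: fI)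
  have "{(\<kappa>, \<nu>) \<in> I \<times> I. \<kappa> < \<nu>} \<subseteq> I \<times> I" by blast
  then have "finite {(\<kappa>, \<nu>) \<in> I \<times> I. \<kappa> < \<nu>}" by (rule finite_subset) (simp add: fI)
  then have fM: "finite ({(\<kappa>, \<nu>) \<in> I \<times> I. \<kappa> < \<nu>} - {uv})" by (rule finite_Diff)
  show ?thesis unfolding bad_coords_def
    by (intro finite_UnI finite_imageI fM finite_cartesian_product fI fL finite_Diff finite_lessThan)
qed

lemma finite_pair_coords: "finite (pair_coords r a b)"
  unfolding pair_coords_def by simp

lemma polys_if: "(B \<Longrightarrow> f \<in> polys V) \<Longrightarrow> (\<not> B \<Longrightarrow> g \<in> polys V) \<Longrightarrow>
    (\<lambda>t. if B then f t else g t) \<in> polys V"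
  by (cases B) auto

lemma bad_param_polys:
  assumes I: "I \<subseteq> {..<r}" and L: "L \<subseteq> I \<times> {..<2}" and \<tau>: "\<tau> \<in> pair_coords r a b"
  shows "(\<lambda>t. bad_param r I L uv t \<tau>) \<in> polys (bad_coords r a b I L uv)"
proof -
  let ?V = "bad_coords r a b I L uv"
  note var = polys_var[OF finite_bad_coords[OF I L]]
  have VC: "C_coord p q \<in> ?V" if "p \<in> {..<r} - I" "q \<in> I" for p q
    using that unfolding bad_coords_def by force
  have VM: "M_coord p q \<in> ?V" if "p \<in> I" "q \<in> I" "p < q" "(p, q) \<noteq> uv" for p q
    using that unfolding bad_coords_def by force
  have VA: "A_coord l e \<in> ?V" if "l \<in> L" "e \<in> I \<times> {..<2} - L" for l e
    using that unfolding bad_coords_def by force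
  have VF: "F_coord i e \<in> ?V" if "i < a" "e \<in> L \<or> e \<in> ({..<r} - I) \<times> {..<2}" for i e
    using that unfolding bad_coords_def by force
  have VG: "G_coord j e \<in> ?V" if "j < b" "e \<in> {..<r} \<times> {..<2}" "e \<notin> L" for j e
    using that unfolding bad_coords_def by force
  have skew: "(\<lambda>t. skew_entry uv t \<kappa> \<nu>) \<in> polys ?V" if "\<kappa> \<in> I" "\<nu> \<in> I" for \<kappa> \<nu>
    unfolding skew_entry_def using that
    by (intro polys_if polys_minus polys_const var VM) auto
  have row: "(\<lambda>t. row_entry L t i e) \<in> polys ?V" if "i < a" "e \<in> I \<times> {..<2}" for i e
    unfolding row_entry_def using that
    by (intro polys_if polys_sum polys_mult var VF VA) auto
  show ?thesis
  proof (cases \<tau>)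
    case (F_coord i e)
    obtain q c where e: "e = (q, c)" by fastforce
    have b: "i < a" "q < r" "c < 2" using \<tau> F_coord e unfolding pair_coords_def by auto
    show ?thesis unfolding F_coord e bad_param.simps
      using b I by (intro polys_if polys_diff polys_sum polys_mult row skew var VF VC) auto
  next
    case (G_coord j e)
    obtain q c where e: "e = (q, c)" by fastforce
    have b: "j < b" "q < r" "c < 2" using \<tau> G_coord e unfolding pair_coords_def by auto
    show ?thesis unfolding G_coord e bad_param.simps
      using b I L by (intro polys_if polys_diff polys_minus polys_sum polys_mult var VG VC VA) auto
  qed (auto simp: polys_const)
qed

definition skew_pairing :: "nat \<Rightarrow> (nat \<Rightarrow> nat \<times> nat \<Rightarrow> 'k::field) \<Rightarrow> (nat \<Rightarrow> nat \<times> nat \<Rightarrow> 'k) \<Rightarrow>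
    (nat \<Rightarrow> nat \<Rightarrow> 'k) \<Rightarrow> nat \<Rightarrow> nat \<Rightarrow> 'k" where
  "skew_pairing r F G \<Omega> i j = (\<Sum>p<r. \<Sum>q<r. \<Omega> p q * (\<Sum>c<2. F i (p, c) * G j (q, c)))"

text \<open>Injectivity of the induced map from the exterior square to a by b matrices. Skewness
  carries the support condition over to the second index.\<close>

definition separating :: "nat \<Rightarrow> nat \<Rightarrow> nat \<Rightarrow> (nat \<Rightarrow> nat \<times> nat \<Rightarrow> 'k::field) \<Rightarrow> (nat \<Rightarrow> nat \<times> nat \<Rightarrow> 'k) \<Rightarrow> bool" where
  "separating r a b F G \<longleftrightarrow> (\<forall>\<Omega>. (\<forall>p q. \<Omega> p q = - \<Omega> q p) \<and> (\<forall>p q. \<Omega> p q \<noteq> 0 \<longrightarrow> p < r) \<and>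
     (\<forall>i<a. \<forall>j<b. skew_pairing r F G \<Omega> i j = 0) \<longrightarrow> (\<forall>p q. \<Omega> p q = 0))"

lemma separatingD:
  assumes "separating r a b F G" "\<And>p q. \<Omega> p q = - \<Omega> q p" "\<And>p q. \<Omega> p q \<noteq> 0 \<Longrightarrow> p < r"
    "\<And>i j. i < a \<Longrightarrow> j < b \<Longrightarrow> skew_pairing r F G \<Omega> i j = 0"
  shows "\<Omega> p q = 0"
proof -
  have "(\<forall>p q. \<Omega> p q = - \<Omega> q p) \<and> (\<forall>p q. \<Omega> p q \<noteq> 0 \<longrightarrow> p < r) \<and>
      (\<forall>i<a. \<forall>j<b. skew_pairing r F G \<Omega> i j = 0)"
    by (intro conjI allI impI) (fact assms(2), erule assms(3), erule (1) assms(4))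
  then show ?thesis using assms(1) unfolding separating_def by blast
qed

lemma sum_swap_pairs:
  "(\<Sum>p\<in>A. \<Sum>q\<in>B. \<Sum>x\<in>X. \<Sum>y\<in>Y. f p q x y) = (\<Sum>y\<in>Y. \<Sum>x\<in>X. \<Sum>p\<in>A. \<Sum>q\<in>B. f p q x y)"
proof -
  have "(\<Sum>p\<in>A. \<Sum>q\<in>B. \<Sum>x\<in>X. \<Sum>y\<in>Y. f p q x y) =
      (\<Sum>z\<in>A \<times> B. \<Sum>w\<in>X \<times> Y. f (fst z) (snd z) (fst w) (snd w))"
    by (simp add: sum.cartesian_product' case_prod_beta)
  also have "\<dots> = (\<Sum>w\<in>X \<times> Y. \<Sum>z\<in>A \<times> B. f (fst z) (snd z) (fst w) (snd w))"
    by (rule sum.swap)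
  also have "\<dots> = (\<Sum>x\<in>X. \<Sum>y\<in>Y. \<Sum>p\<in>A. \<Sum>q\<in>B. f p q x y)"
    by (simp add: sum.cartesian_product' case_prod_beta)
  also have "\<dots> = (\<Sum>y\<in>Y. \<Sum>x\<in>X. \<Sum>p\<in>A. \<Sum>q\<in>B. f p q x y)"
    by (rule sum.swap)
  finally show ?thesis .
qed

text \<open>The annihilating form is \<open>C N C\<^sup>T\<close> with \<open>C\<close> the identity on \<open>I\<close>, and \<open>M\<close> is the inverse of
  \<open>N\<close>, scaled to have entry 1 at \<open>uv\<close>. Parametrizing by \<open>M\<close> rather than by \<open>N\<close> makes the map
  polynomial: the rows of \<open>F C N\<close> are arbitrary vectors of the space with reduced basis \<open>A\<close>, the
  rows of \<open>G C\<close> are orthogonal to that space, and \<open>F C\<close> is recovered by means of \<open>M\<close>.\<close>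

lemma annihilated_in_bad_param:
  fixes F G :: "nat \<Rightarrow> nat \<times> nat \<Rightarrow> 'k::field_char_0" and \<Omega> :: "nat \<Rightarrow> nat \<Rightarrow> 'k"
  assumes skew: "\<And>p q. \<Omega> p q = - \<Omega> q p" and supp: "\<And>p q. \<Omega> p q \<noteq> 0 \<Longrightarrow> p < r"
    and nz: "\<Omega> p0 q0 \<noteq> 0"
    and ann: "\<And>i j. i < a \<Longrightarrow> j < b \<Longrightarrow> skew_pairing r F G \<Omega> i j = 0"
  obtains I L uv t where "I \<subseteq> {..<r}" "L \<subseteq> I \<times> {..<2}" "card L \<le> a" "uv \<in> I \<times> I" "fst uv < snd uv"
    "\<And>i e. i < a \<Longrightarrow> e \<in> {..<r} \<times> {..<2} \<Longrightarrow> bad_param r I L uv t (F_coord i e) = F i e"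
    "\<And>j e. j < b \<Longrightarrow> e \<in> {..<r} \<times> {..<2} \<Longrightarrow> bad_param r I L uv t (G_coord j e) = G j e"
proof -
  have supp': "p \<in> {..<r}" if "\<Omega> p q \<noteq> 0" for p q using supp[OF that] by simp
  show ?thesis
  proof (rule skew_form_decomposition[of "{..<r}" \<Omega>, OF finite_lessThan skew supp'])
    fix I :: "nat set" and C M :: "nat \<Rightarrow> nat \<Rightarrow> 'k"
    assume I: "I \<subseteq> {..<r}"
      and CI: "\<And>p \<kappa>. p \<in> I \<Longrightarrow> \<kappa> \<in> I \<Longrightarrow> C p \<kappa> = (if p = \<kappa> then 1 else 0)"
      and dec: "\<And>p q. \<Omega> p q = (\<Sum>\<iota>\<in>I. \<Sum>\<kappa>\<in>I. C p \<iota> * \<Omega> \<iota> \<kappa> * C q \<kappa>)"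
      and Mskew: "\<And>\<iota> \<kappa>. \<iota> \<in> I \<Longrightarrow> \<kappa> \<in> I \<Longrightarrow> M \<iota> \<kappa> = - M \<kappa> \<iota>"
      and inv: "\<And>\<iota> \<nu>. \<iota> \<in> I \<Longrightarrow> \<nu> \<in> I \<Longrightarrow> (\<Sum>\<kappa>\<in>I. \<Omega> \<iota> \<kappa> * M \<kappa> \<nu>) = (if \<iota> = \<nu> then 1 else 0)"
    have finI: "finite I" using I finite_subset by blast
    define E where "E = I \<times> {..<2::nat}"
    have finE: "finite E" unfolding E_def using finI by simp
    \<comment> \<open>M has a nonzero entry above the diagonal: I is nonempty because \<Omega> is
      nonzero, no column of an inverse vanishes, and the diagonal of the skew M is zero in
      characteristic zero.\<close>
    obtain \<iota> where \<iota>: "\<iota> \<in> I" using nz dec[of p0 q0] by force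
    obtain \<kappa> where \<kappa>: "\<kappa> \<in> I" "M \<kappa> \<iota> \<noteq> 0"
      using inv[OF \<iota> \<iota>] by (metis (no_types, lifting) mult_zero_right sum.neutral zero_neq_one)
    have M0: "M \<iota> \<iota> = 0" if "\<iota> \<in> I" for \<iota> using Mskew[OF that that] by (simp add: equal_neg_zero)
    have "\<kappa> \<noteq> \<iota>" using M0 \<iota> \<kappa> by blast
    then obtain u v where uv: "u \<in> I" "v \<in> I" "u < v" "M u v \<noteq> 0"
      using \<iota> \<kappa> Mskew[OF \<iota> \<kappa>(1)] by (metis neg_equal_0_iff_equal nat_neq_iff)
    define m where "m = M u v"
    have m: "m \<noteq> 0" using uv by (simp add: m_def)

    define red where "red X e = (\<Sum>p<r. C p (fst e) * X (p, snd e))"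
      for X :: "nat \<times> nat \<Rightarrow> 'k" and e :: "nat \<times> nat"
    have red: "X (q, c) = red X (q, c) - (\<Sum>p\<in>{..<r} - I. C p q * X (p, c))" if "q \<in> I" for X q c
    proof -
      have "red X (q, c) = (\<Sum>p\<in>I. C p q * X (p, c)) + (\<Sum>p\<in>{..<r} - I. C p q * X (p, c))"
        unfolding red_def using sum.subset_diff[OF I finite_lessThan] by (simp add: add.commute)
      also have "(\<Sum>p\<in>I. C p q * X (p, c)) = X (q, c)"
        using finI that CI by (intro sum_mult_delta(2)) auto
      finally show ?thesis by simp
    qed
    \<comment> \<open>The paired rows F C N, set to zero outside E so that their span meets the
      support condition of \<open>reduced_basis\<close>.\<close>
    define h where "h i e = (if e \<in> E then \<Sum>\<iota>\<in>I. red (F i) (\<iota>, snd e) * \<Omega> \<iota> (fst e) else 0)" for i e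
    \<comment> \<open>Factoring \<Omega> moves one copy of C onto F and the other onto G, so
      annihilation becomes orthogonality of the paired rows to the rows of G C.\<close>
    have orth: "(\<Sum>e\<in>E. h i e * red (G j) e) = 0" if "i < a" "j < b" for i j
    proof -
      have "0 = (\<Sum>p<r. \<Sum>q<r. \<Sum>c<2. \<Omega> p q * (F i (p, c) * G j (q, c)))"
        using ann that by (simp add: skew_pairing_def sum_distrib_left)
      also have "\<dots> = (\<Sum>p<r. \<Sum>c<2. \<Sum>q<r. \<Omega> p q * (F i (p, c) * G j (q, c)))"
        by (intro sum.cong refl sum.swap)
      also have "\<dots> = (\<Sum>c<2. \<Sum>p<r. \<Sum>q<r. \<Omega> p q * (F i (p, c) * G j (q, c)))"
        by (rule sum.swap)
      also have "\<dots> = (\<Sum>c<2. \<Sum>\<kappa>\<in>I. h i (\<kappa>, c) * red (G j) (\<kappa>, c))"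
      proof (rule sum.cong[OF refl])
        fix c :: nat assume c: "c \<in> {..<2}"
        have "(\<Sum>p<r. \<Sum>q<r. \<Omega> p q * (F i (p, c) * G j (q, c))) =
            (\<Sum>p<r. \<Sum>q<r. \<Sum>\<iota>\<in>I. \<Sum>\<kappa>\<in>I. C p \<iota> * F i (p, c) * \<Omega> \<iota> \<kappa> * (C q \<kappa> * G j (q, c)))"
          by (subst dec, simp only: sum_distrib_right, simp only: mult_ac)
        also have "\<dots> = (\<Sum>\<kappa>\<in>I. \<Sum>\<iota>\<in>I. \<Sum>p<r. \<Sum>q<r. C p \<iota> * F i (p, c) * \<Omega> \<iota> \<kappa> * (C q \<kappa> * G j (q, c)))"
          by (rule sum_swap_pairs)
        also have "\<dots> = (\<Sum>\<kappa>\<in>I. \<Sum>\<iota>\<in>I. red (F i) (\<iota>, c) * \<Omega> \<iota> \<kappa> * red (G j) (\<kappa>, c))"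
        proof (intro sum.cong refl)
          fix \<kappa> \<iota>
          have "(\<Sum>p<r. \<Sum>q<r. C p \<iota> * F i (p, c) * \<Omega> \<iota> \<kappa> * (C q \<kappa> * G j (q, c))) =
              (\<Sum>p<r. C p \<iota> * F i (p, c) * \<Omega> \<iota> \<kappa>) * (\<Sum>q<r. C q \<kappa> * G j (q, c))"
            by (rule sum_product[symmetric])
          then show "(\<Sum>p<r. \<Sum>q<r. C p \<iota> * F i (p, c) * \<Omega> \<iota> \<kappa> * (C q \<kappa> * G j (q, c))) =
              red (F i) (\<iota>, c) * \<Omega> \<iota> \<kappa> * red (G j) (\<kappa>, c)"
            by (simp only: red_def fst_conv snd_conv sum_distrib_right)
        qed
        also have "\<dots> = (\<Sum>\<kappa>\<in>I. h i (\<kappa>, c) * red (G j) (\<kappa>, c))"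
          using c by (intro sum.cong refl) (simp add: h_def E_def sum_distrib_right)
        finally show "(\<Sum>p<r. \<Sum>q<r. \<Omega> p q * (F i (p, c) * G j (q, c))) =
            (\<Sum>\<kappa>\<in>I. h i (\<kappa>, c) * red (G j) (\<kappa>, c))" .
      qed
      also have "\<dots> = (\<Sum>\<kappa>\<in>I. \<Sum>c<2. h i (\<kappa>, c) * red (G j) (\<kappa>, c))" by (rule sum.swap)
      also have "\<dots> = (\<Sum>e\<in>E. h i e * red (G j) e)" by (simp add: E_def sum.cartesian_product split_def)
      finally show ?thesis by simp
    qed
    have recover: "red (F i) (\<nu>, c) = (\<Sum>\<kappa>\<in>I. h i (\<kappa>, c) * M \<kappa> \<nu>)" if "\<nu> \<in> I" "c < 2" for i \<nu> c
    proof -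
      have "(\<Sum>\<kappa>\<in>I. h i (\<kappa>, c) * M \<kappa> \<nu>) = (\<Sum>\<kappa>\<in>I. \<Sum>\<iota>\<in>I. red (F i) (\<iota>, c) * (\<Omega> \<iota> \<kappa> * M \<kappa> \<nu>))"
        using that by (intro sum.cong refl) (simp add: h_def E_def sum_distrib_right mult.assoc)
      also have "\<dots> = (\<Sum>\<iota>\<in>I. red (F i) (\<iota>, c) * (\<Sum>\<kappa>\<in>I. \<Omega> \<iota> \<kappa> * M \<kappa> \<nu>))"
        by (subst sum.swap) (simp add: sum_distrib_left)
      also have "\<dots> = red (F i) (\<nu>, c)"
        using that finI inv by (intro sum_mult_delta(1)) auto
      finally show ?thesis by simp
    qed

    define S where "S = h ` {..<a}"
    define U where "U = fun_vs.span S"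
    have U_supp: "x e = 0" if "x \<in> U" "e \<notin> E" for x e
    proof -
      have "fun_vs.subspace {x :: nat \<times> nat \<Rightarrow> 'k. x e = 0}"
        by (auto simp: fun_vs.subspace_def fun_scale_def)
      then have "U \<subseteq> {x. x e = 0}"
        unfolding U_def S_def using that(2) by (intro fun_vs.span_minimal) (auto simp: h_def)
      then show ?thesis using that by auto
    qed
    have U_orth: "(\<Sum>e\<in>E. x e * red (G j) e) = 0" if "x \<in> U" "j < b" for x j
    proof -
      have "fun_vs.subspace {x :: nat \<times> nat \<Rightarrow> 'k. (\<Sum>e\<in>E. x e * red (G j) e) = 0}"
        by (auto simp: fun_vs.subspace_def fun_scale_def distrib_right sum.distrib mult.assoc
            simp flip: sum_distrib_left)
      then have "U \<subseteq> {x. (\<Sum>e\<in>E. x e * red (G j) e) = 0}"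
        unfolding U_def S_def using orth that(2) by (intro fun_vs.span_minimal) auto
      then show ?thesis using that by auto
    qed
    obtain L \<alpha> where L: "L \<subseteq> E" and \<alpha>U: "\<And>l. l \<in> L \<Longrightarrow> \<alpha> l \<in> U"
      and dual: "\<And>l l'. l \<in> L \<Longrightarrow> l' \<in> L \<Longrightarrow> \<alpha> l l' = (if l = l' then 1 else 0)"
      and expand: "\<And>x e. x \<in> U \<Longrightarrow> x e = (\<Sum>l\<in>L. x l * \<alpha> l e)"
      by (rule reduced_basis[OF finE, of U]) (use U_supp in \<open>auto simp: U_def\<close>)
    have finL: "finite L" using L finE finite_subset by blast
    have "card L \<le> card S"
      by (rule card_dual_family_le[OF finL _ \<alpha>U[unfolded U_def] dual]) (simp_all add: S_def)
    also have "\<dots> \<le> a" unfolding S_def using card_image_le[of "{..<a}" h] by simp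
    finally have cardL: "card L \<le> a" .
    have hU: "h i \<in> U" if "i < a" for i
      unfolding U_def S_def using that by (intro fun_vs.span_base) auto
    have G_L: "red (G j) l = - (\<Sum>e\<in>E - L. \<alpha> l e * red (G j) e)" if "l \<in> L" "j < b" for l j
    proof -
      have "0 = (\<Sum>e\<in>E - L. \<alpha> l e * red (G j) e) + (\<Sum>e\<in>L. \<alpha> l e * red (G j) e)"
        using U_orth[OF \<alpha>U that(2)] that sum.subset_diff[OF L finE] by metis
      also have "(\<Sum>e\<in>L. \<alpha> l e * red (G j) e) = red (G j) l"
        using that dual by (intro sum_mult_delta(2) finL) auto
      finally show ?thesis by (simp add: eq_neg_iff_add_eq_0 add.commute)
    qed

    \<comment> \<open>Dividing M by m puts 1 at position (u, v); multiplying the paired rows by m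
      leaves their product with M unchanged. The basis \<alpha> is not rescaled, since the span of
      the rows stays the same.\<close>
    define t where "t x = (case x of C_coord p q \<Rightarrow> C p q | M_coord \<kappa> \<nu> \<Rightarrow> M \<kappa> \<nu> / m | A_coord l e \<Rightarrow> \<alpha> l e
        | F_coord i e \<Rightarrow> if e \<in> E then m * h i e else F i e
        | G_coord j e \<Rightarrow> if e \<in> E then red (G j) e else G j e)" for x
    have t: "t (C_coord p q) = C p q" "t (M_coord p q) = M p q / m" "t (A_coord l e) = \<alpha> l e"
      "t (F_coord i e) = (if e \<in> E then m * h i e else F i e)"
      "t (G_coord i e) = (if e \<in> E then red (G i) e else G i e)" for p q l e i
      by (simp_all add: t_def)
    have sk: "skew_entry (u, v) t \<kappa> \<nu> = M \<kappa> \<nu> / m" if "\<kappa> \<in> I" "\<nu> \<in> I" for \<kappa> \<nu>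
    proof (cases \<kappa> \<nu> rule: linorder_cases)
      case less
      then show ?thesis using uv by (auto simp: skew_entry_def t m_def)
    next
      case equal
      then show ?thesis using M0 that by (simp add: skew_entry_def)
    next
      case greater
      then show ?thesis using uv by (subst Mskew[OF that]) (auto simp: skew_entry_def t m_def)
    qed
    have rw: "row_entry L t i e = m * h i e" if "i < a" "e \<in> E" for i e
    proof (cases "e \<in> L")
      case False
      have "row_entry L t i e = (\<Sum>l\<in>L. m * (h i l * \<alpha> l e))"
        using False L by (auto simp: row_entry_def t mult.assoc intro!: sum.cong)
      also have "\<dots> = m * h i e"
        by (subst expand[OF hU[OF that(1)], of e]) (rule sum_distrib_left[symmetric])
      finally show ?thesis .
    qed (use that in \<open>simp add: row_entry_def t\<close>)
    show ?thesis
    proof (rule that[of I L "(u, v)" t])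
      fix i e assume i: "i < a" and e: "e \<in> {..<r} \<times> {..<2::nat}"
      obtain q c where qc: "e = (q, c)" by fastforce
      show "bad_param r I L (u, v) t (F_coord i e) = F i e"
      proof (cases "q \<in> I")
        case True
        have "(\<Sum>\<kappa>\<in>I. row_entry L t i (\<kappa>, c) * skew_entry (u, v) t \<kappa> q) = red (F i) (q, c)"
          using True e qc i m by (subst recover) (auto simp: rw sk E_def intro!: sum.cong)
        moreover have "(\<Sum>p\<in>{..<r} - I. t (C_coord p q) * t (F_coord i (p, c))) = (\<Sum>p\<in>{..<r} - I. C p q * F i (p, c))"
          by (intro sum.cong) (auto simp: t E_def)
        ultimately show ?thesis using red[OF True, of "F i" c] True by (simp add: qc)
      qed (auto simp: qc t E_def)
    next
      fix j e assume j: "j < b" and e: "e \<in> {..<r} \<times> {..<2::nat}"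
      obtain q c where qc: "e = (q, c)" by fastforce
      show "bad_param r I L (u, v) t (G_coord j e) = G j e"
      proof (cases "q \<in> I")
        case True
        then have qE: "(q, c) \<in> E" using e qc by (auto simp: E_def)
        have "(\<Sum>e\<in>I \<times> {..<2} - L. t (A_coord (q, c) e) * t (G_coord j e)) = (\<Sum>e\<in>E - L. \<alpha> (q, c) e * red (G j) e)"
          by (intro sum.cong) (auto simp: t E_def)
        then have "(if (q, c) \<in> L then - (\<Sum>e\<in>I \<times> {..<2} - L. t (A_coord (q, c) e) * t (G_coord j e))
           else t (G_coord j (q, c))) = red (G j) (q, c)"
          using G_L[of "(q, c)" j] j qE by (simp add: t)
        moreover have "(\<Sum>p\<in>{..<r} - I. t (C_coord p q) * t (G_coord j (p, c))) = (\<Sum>p\<in>{..<r} - I. C p q * G j (p, c))"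
          by (intro sum.cong) (auto simp: t E_def)
        ultimately show ?thesis using red[OF True, of "G j" c] True by (simp only: qc bad_param.simps if_True)
      qed (auto simp: qc t E_def)
    qed (use I L cardL uv in \<open>auto simp: E_def\<close>)
  qed
qed

section \<open>Dimension count\<close>

lemma card_less_pairs:
  fixes I :: "nat set"
  assumes "finite I"
  shows "2 * card {(x, y) \<in> I \<times> I. x < y} + card I = card I * card I"
proof -
  let ?A = "{(x, y) \<in> I \<times> I. x < y}" and ?D = "(\<lambda>x. (x, x)) ` I"
  have "?A \<subseteq> I \<times> I" by blast
  then have fA: "finite ?A" by (rule finite_subset) (simp add: assms)
  have "I \<times> I = (?A \<union> prod.swap ` ?A) \<union> ?D"
    by (auto simp: image_iff split_def)
  then have "card (I \<times> I) = card (?A \<union> prod.swap ` ?A \<union> ?D)" by (simp only:)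
  also have "\<dots> = card (?A \<union> prod.swap ` ?A) + card ?D"
    using fA assms by (intro card_Un_disjoint) auto
  also have "card (?A \<union> prod.swap ` ?A) = card ?A + card (prod.swap ` ?A)"
    using fA by (intro card_Un_disjoint) auto
  also have "card (prod.swap ` ?A) = card ?A" by (intro card_image) auto
  also have "card ?D = card I" by (intro card_image) (auto simp: inj_on_def)
  finally show ?thesis by (simp add: card_cartesian_product)
qed

text \<open>Twice the inequality of the stratum with rank \<rho>, where k = r - \<rho> and l = 2
  \<rho> - s. The difference of the two sides is quadratic in s and is a sum of nonnegative terms,
  grouped differently for \<rho> <= a and for \<rho> > a.\<close>

lemma parameter_count:
  fixes a b r \<rho> k s l :: nat
  assumes "2 \<le> r" "b \<le> a" "a \<le> b + 1" "r * (r - 1) \<le> 2 * a * b"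
    and "r = \<rho> + k" "s + l = 2 * \<rho>" "s \<le> a"
  shows "2 * k * \<rho> + \<rho> * \<rho> + 2 * s * l \<le> 2 * a * l + 2 * b * s + \<rho>"
proof -
  define A B R P K S where "A = int a" "B = int b" "R = int r" "P = int \<rho>" "K = int k" "S = int s"
  note d = this
  have h: "2 \<le> R" "B \<le> A" "A \<le> B + 1" "R = P + K" "S \<le> A" "0 \<le> B" "0 \<le> P" "0 \<le> K" "0 \<le> S"
    using assms by (auto simp: d)
  have n: "R * (R - 1) \<le> 2 * A * B"
  proof -
    have "int (r * (r - 1)) \<le> int (2 * a * b)" using assms(4) by (rule of_nat_mono)
    then show ?thesis using assms(1) by (simp add: d of_nat_diff)
  qed
  have l: "int l = 2 * P - S" using assms(6) by (simp add: d)
  \<comment> \<open>Otherwise (2 R - 2)^2 >= (A + 2 B)^2 >= 8 A B >= 4 R (R - 1), which fails for R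
    > 1.\<close>
  have sum: "2 * R - 1 \<le> A + 2 * B"
  proof (rule ccontr)
    assume "\<not> ?thesis"
    then have "A + 2 * B \<le> 2 * R - 2" by simp
    then have "(A + 2 * B)\<^sup>2 \<le> (2 * R - 2)\<^sup>2" using h by (intro power_mono) auto
    moreover have "8 * (A * B) \<le> (A + 2 * B)\<^sup>2"
      using zero_le_power2[of "A - 2 * B"] by (simp add: power2_eq_square algebra_simps)
    ultimately have "4 * (R * (R - 1)) \<le> (2 * R - 2)\<^sup>2" using n by linarith
    then show False using h by (simp add: power2_eq_square algebra_simps)
  qed
  have "2 * K * P + P * P + 2 * S * (2 * P - S) \<le> 2 * A * (2 * P - S) + 2 * B * S + P"
  proof (cases "P \<le> A")
    case True
    \<comment> \<open>The right side minus the left side is twice this product plus the multiple of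
      P below. The product is nonnegative because S - P is an integer and A - B is 0 or 1.\<close>
    have "0 \<le> (S - P) * (S - P - (A - B))"
    proof (cases "S \<le> P")
      case True then show ?thesis using h by (intro mult_nonpos_nonpos) auto
    next
      case False then show ?thesis using h by (intro mult_nonneg_nonneg) auto
    qed
    moreover have "0 \<le> P * (2 * (A + B) - (2 * R + P - 1))"
      using True sum h by (intro mult_nonneg_nonneg) auto
    ultimately show ?thesis unfolding \<open>R = P + K\<close> by (simp add: algebra_simps)
  next
    case False
    \<comment> \<open>Here the right side minus the left side is twice this product plus K (K - 1)
      plus the slack 2 A B - R (R - 1).\<close>
    have "0 \<le> (A - S) * (2 * P - S - B)" using False h by (intro mult_nonneg_nonneg) auto
    moreover have "0 \<le> K * (K - 1)" using h(8) by (cases "K = 0") auto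
    ultimately show ?thesis using n unfolding \<open>R = P + K\<close> by (simp add: algebra_simps)
  qed
  then have "int (2 * k * \<rho> + \<rho> * \<rho> + 2 * s * l) \<le> int (2 * a * l + 2 * b * s + \<rho>)"
    unfolding of_nat_add of_nat_mult l by (simp add: d)
  then show ?thesis by (simp only: of_nat_le_iff)
qed

lemma card_pair_coords: "card (pair_coords r a b) = (a + b) * (2 * r)"
proof -
  have "card (pair_coords r a b) = card (case_prod F_coord ` ({..<a} \<times> ({..<r} \<times> {..<2::nat})))
      + card (case_prod G_coord ` ({..<b} \<times> ({..<r} \<times> {..<2::nat})))"
    unfolding pair_coords_def by (rule card_Un_disjoint) auto
  also have "\<dots> = card ({..<a} \<times> ({..<r} \<times> {..<2::nat})) + card ({..<b} \<times> ({..<r} \<times> {..<2::nat}))"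
    by (intro arg_cong2[where f = "(+)"] card_image) (auto simp: inj_on_def)
  finally show ?thesis by (simp add: card_cartesian_product algebra_simps)
qed

lemma card_bad_coords_less:
  assumes r: "2 \<le> r" and ab: "b \<le> a" "a \<le> b + 1" "r * (r - 1) \<le> 2 * a * b"
    and I: "I \<subseteq> {..<r}" and L: "L \<subseteq> I \<times> {..<2}" "card L \<le> a"
    and uv: "uv \<in> I \<times> I" "fst uv < snd uv"
  shows "card (bad_coords r a b I L uv) < card (pair_coords r a b)"
proof -
  have fI: "finite I" using I by (rule finite_subset) simp
  have fL: "finite L" using L(1) by (rule finite_subset) (simp add: fI)
  let ?M = "{(\<kappa>, \<nu>) \<in> I \<times> I. \<kappa> < \<nu>}"
  have "?M \<subseteq> I \<times> I" by blast
  then have fM: "finite ?M" by (rule finite_subset) (simp add: fI)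
  define \<rho> k s l where \<rho>_k_s_l_def: "\<rho> = card I" "k = r - \<rho>" "s = card L" "l = 2 * \<rho> - s"
  note d = \<rho>_k_s_l_def
  have rk: "r = \<rho> + k" using card_mono[OF finite_lessThan I] by (simp add: d)
  have "s \<le> card (I \<times> {..<2::nat})" unfolding d using L(1) fI by (intro card_mono) auto
  then have sl: "s + l = 2 * \<rho>" by (simp add: d card_cartesian_product)
  have Lr: "L \<subseteq> {..<r} \<times> {..<2}" using L(1) I by blast
  have cI: "card ({..<r} - I) = k" by (simp add: d card_Diff_subset[OF fI I])
  have cL: "card (I \<times> {..<2} - L) = l"
    by (simp add: d card_Diff_subset[OF fL L(1)] card_cartesian_product)
  have cG: "card ({..<r} \<times> {..<2} - L) = l + 2 * k"
  proof -
    have "card ({..<r} \<times> {..<2} - L) = r * 2 - s"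
      by (subst card_Diff_subset[OF fL Lr]) (simp add: card_cartesian_product \<rho>_k_s_l_def(3))
    then show ?thesis using sl rk by simp
  qed
  \<comment> \<open>The normalized entry costs no parameter; this saving makes the final inequality
    strict.\<close>
  have "uv \<in> ?M" using uv by auto
  then have cM: "Suc (card (?M - {uv})) = card ?M" by (rule card_Suc_Diff1[OF fM])
  have M2: "2 * card ?M + \<rho> = \<rho> * \<rho>" unfolding d by (rule card_less_pairs[OF fI])
  have cF: "card (L \<union> ({..<r} - I) \<times> {..<2::nat}) \<le> s + 2 * k"
    using card_Un_le[of L "({..<r} - I) \<times> {..<2::nat}"] by (simp add: card_cartesian_product cI d)
  have "card (bad_coords r a b I L uv) \<le> card (({..<r} - I) \<times> I) + card (?M - {uv})
      + card (L \<times> (I \<times> {..<2} - L)) + card ({..<a} \<times> (L \<union> ({..<r} - I) \<times> {..<2}))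
      + card ({..<b} \<times> ({..<r} \<times> {..<2} - L))"
    unfolding bad_coords_def
    by (intro order_trans[OF card_Un_le] add_mono card_image_le finite_Diff fM finite_cartesian_product
        fI fL finite_UnI finite_lessThan)
  also have "\<dots> \<le> k * \<rho> + card (?M - {uv}) + s * l + a * (s + 2 * k) + b * (l + 2 * k)"
    unfolding card_cartesian_product cI cL cG card_lessThan
    using cF by (intro add_mono mult_le_mono) (auto simp: d)
  finally have "card (bad_coords r a b I L uv)
      \<le> k * \<rho> + card (?M - {uv}) + s * l + a * (s + 2 * k) + b * (l + 2 * k)" .
  moreover have "2 * k * \<rho> + \<rho> * \<rho> + 2 * s * l \<le> 2 * a * l + 2 * b * s + \<rho>"
    using parameter_count[OF r ab rk sl] L(2) by (simp add: d)
  then have "k * \<rho> + card ?M + s * l \<le> a * l + b * s" using M2 by simp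
  then have "k * \<rho> + card (?M - {uv}) + s * l + a * (s + 2 * k) + b * (l + 2 * k)
      < (a + b) * (s + l + 2 * k)"
    using cM by (simp add: algebra_simps)
  moreover have "s + l + 2 * k = 2 * r" using sl rk by simp
  ultimately show ?thesis unfolding card_pair_coords by simp
qed

lemma exists_separating_forms:
  assumes r: "2 \<le> r" and ab: "b \<le> a" "a \<le> b + 1" "r * (r - 1) \<le> 2 * a * b"
  obtains F G :: "nat \<Rightarrow> nat \<times> nat \<Rightarrow> 'k::field_char_0" where "separating r a b F G"
proof -
  \<comment> \<open>The index records pivots and the normalized position, not just the two ranks:
    each choice has a single polynomial parametrization, and there are finitely many
    choices.\<close>
  define J where "J = {(I, L, uv). I \<subseteq> {..<r} \<and> L \<subseteq> I \<times> {..<2::nat} \<and> card L \<le> a \<and> uv \<in> I \<times> I \<and> fst uv < snd uv}"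
  have "J \<subseteq> Pow {..<r} \<times> Pow ({..<r} \<times> {..<2}) \<times> ({..<r} \<times> {..<r})"
    unfolding J_def by auto
  then have finJ: "finite J" by (rule finite_subset) simp
  obtain x :: "coord \<Rightarrow> 'k" where x:
    "\<And>z t. z \<in> J \<Longrightarrow> \<exists>\<tau>\<in>pair_coords r a b. (case z of (I, L, uv) \<Rightarrow> bad_param r I L uv) t \<tau> \<noteq> x \<tau>"
  proof (rule polynomial_images_not_covering[OF finJ finite_pair_coords,
      where V = "\<lambda>(I, L, uv). bad_coords r a b I L uv" and \<Phi> = "\<lambda>(I, L, uv). bad_param r I L uv"])
    fix z assume "z \<in> J"
    then obtain I L uv where z: "z = (I, L, uv)" "I \<subseteq> {..<r}" "L \<subseteq> I \<times> {..<2}" "card L \<le> a"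
      "uv \<in> I \<times> I" "fst uv < snd uv" by (auto simp: J_def)
    show "finite (case z of (I, L, uv) \<Rightarrow> bad_coords r a b I L uv)"
      using finite_bad_coords[OF z(2,3)] by (simp add: z(1))
    show "card (case z of (I, L, uv) \<Rightarrow> bad_coords r a b I L uv) < card (pair_coords r a b)"
      using card_bad_coords_less[OF r ab z(2-6)] by (simp add: z(1))
    fix \<tau> assume "\<tau> \<in> pair_coords r a b"
    then show "(\<lambda>t. (case z of (I, L, uv) \<Rightarrow> bad_param r I L uv) t \<tau>)
        \<in> polys (case z of (I, L, uv) \<Rightarrow> bad_coords r a b I L uv)"
      using bad_param_polys[OF z(2,3)] by (simp add: z(1))
  qed (rule that)
  let ?F = "\<lambda>i e. x (F_coord i e)" and ?G = "\<lambda>j e. x (G_coord j e)"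
  have "separating r a b ?F ?G"
    unfolding separating_def
  proof (intro allI impI, elim conjE, rule ccontr)
    fix \<Omega> :: "nat \<Rightarrow> nat \<Rightarrow> 'k" and p0 q0
    assume skew: "\<forall>p q. \<Omega> p q = - \<Omega> q p" and supp: "\<forall>p q. \<Omega> p q \<noteq> 0 \<longrightarrow> p < r"
      and ann: "\<forall>i<a. \<forall>j<b. skew_pairing r ?F ?G \<Omega> i j = 0"
      and nz: "\<Omega> p0 q0 \<noteq> 0"
    show False
    proof (rule annihilated_in_bad_param[of \<Omega> r p0 q0 a b ?F ?G,
          OF skew[rule_format] supp[rule_format] nz ann[rule_format]])
      fix I L uv t
      assume h: "I \<subseteq> {..<r}" "L \<subseteq> I \<times> {..<2}" "card L \<le> a" "uv \<in> I \<times> I" "fst uv < snd uv"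
        and F: "\<And>i e. i < a \<Longrightarrow> e \<in> {..<r} \<times> {..<2} \<Longrightarrow> bad_param r I L uv t (F_coord i e) = x (F_coord i e)"
        and G: "\<And>j e. j < b \<Longrightarrow> e \<in> {..<r} \<times> {..<2} \<Longrightarrow> bad_param r I L uv t (G_coord j e) = x (G_coord j e)"
      have "(I, L, uv) \<in> J" using h by (simp add: J_def)
      from x[OF this, of t] obtain \<tau> where \<tau>: "\<tau> \<in> pair_coords r a b" "bad_param r I L uv t \<tau> \<noteq> x \<tau>"
        by auto
      from \<tau>(1) consider i e where "\<tau> = F_coord i e" "i < a" "e \<in> {..<r} \<times> {..<2}"
        | j e where "\<tau> = G_coord j e" "j < b" "e \<in> {..<r} \<times> {..<2}"
        unfolding pair_coords_def by auto
      then show False using F G \<tau>(2) by cases simp_all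
    qed
  qed
  then show ?thesis by (rule that)
qed

section \<open>The representation attached to a pair of tensors\<close>

text \<open>Coordinates below a belong to the u's, the next two to the v's, the rest to the w's. The
  block B is stored transposed, so that the corner of a product is a sum over c of
  \<open>A i c * B j c\<close>, the shape of \<open>skew_pairing\<close>.\<close>

definition block_action :: "nat \<Rightarrow> nat \<Rightarrow> (nat \<Rightarrow> nat \<Rightarrow> 'k::field) \<Rightarrow> (nat \<Rightarrow> nat \<Rightarrow> 'k) \<Rightarrow>
    (nat \<Rightarrow> nat \<Rightarrow> 'k) \<Rightarrow> (nat \<Rightarrow> 'k) \<Rightarrow> nat \<Rightarrow> 'k" where
  "block_action a b A B T v = (\<lambda>k.
     if k < a then (\<Sum>c<2. A k c * v (a + c)) + (\<Sum>j<b. T k j * v (a + 2 + j))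
     else if k < a + 2 then \<Sum>j<b. B j (k - a) * v (a + 2 + j) else 0)"

definition coord_space :: "nat \<Rightarrow> (nat \<Rightarrow> 'k::field) set" where
  "coord_space n = {v. \<forall>i. i \<notin> {..<n} \<longrightarrow> v i = 0}"

lemma span_unit_coord_space: "fun_vs.span (unit_fun ` {..<n}) = coord_space n"
  unfolding coord_space_def by (rule span_unit_fun) simp

lemma fin_dim_coord_space: "fin_dim_subspace (fun_scale :: 'k::field_char_0 \<Rightarrow> _) (coord_space n)"
  by unfold_locales (use span_unit_coord_space in blast)

lemma dim_coord_space: "fun_vs.dim (coord_space n :: (nat \<Rightarrow> 'k::field) set) = n"
proof -
  have "fun_vs.dim (coord_space n :: (nat \<Rightarrow> 'k) set) = card (unit_fun ` {..<n} :: (nat \<Rightarrow> 'k) set)"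
    by (metis fun_vs.dim_span_eq_card_independent independent_unit_fun finite_lessThan span_unit_coord_space)
  then show ?thesis by (simp add: card_image inj_on_subset[OF inj_unit_fun])
qed

lemma representation_unit_fun:
  fixes v :: "nat \<Rightarrow> 'k::field"
  assumes v: "v \<in> coord_space n" and i: "i < n"
  shows "fun_vs.representation (unit_fun ` {..<n}) v (unit_fun i) = v i"
proof -
  let ?B = "unit_fun ` {..<n} :: (nat \<Rightarrow> 'k) set"
  define c where "c i = (if i < n then fun_vs.representation ?B v (unit_fun i) else 0)" for i
  have "v = (\<Sum>b\<in>?B. fun_scale (fun_vs.representation ?B v b) b)"
    by (rule fun_vs.sum_representation_eq[symmetric])
      (simp_all add: independent_unit_fun span_unit_coord_space v)
  also have "\<dots> = (\<Sum>i<n. fun_scale (c i) (unit_fun i))"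
    by (subst sum.reindex[OF inj_on_subset[OF inj_unit_fun subset_UNIV]]) (simp add: c_def)
  also have "\<dots> = c" by (rule sum_unit_fun) (auto simp: c_def)
  finally have "v = c" .
  then show ?thesis using i by (simp add: c_def)
qed

lemma block_action_in_coord_space: "block_action a b A B T v \<in> coord_space (a + 2 + b)"
  by (auto simp: coord_space_def block_action_def)

lemma block_action_add_vec: "block_action a b A B T (u + v) = block_action a b A B T u + block_action a b A B T v"
  by (auto simp: block_action_def fun_eq_iff algebra_simps sum.distrib)

lemma block_action_scale_vec: "block_action a b A B T (fun_scale c v) = fun_scale c (block_action a b A B T v)"
  by (auto simp: block_action_def fun_scale_def fun_eq_iff algebra_simps sum_distrib_left)

lemma block_action_add:
  "block_action a b (\<lambda>i c. A i c + A' i c) (\<lambda>j c. B j c + B' j c) (\<lambda>i j. T i j + T' i j) v =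
   block_action a b A B T v + block_action a b A' B' T' v"
  by (auto simp: block_action_def fun_eq_iff algebra_simps sum.distrib)

lemma block_action_scale:
  "block_action a b (\<lambda>i c. x * A i c) (\<lambda>j c. x * B j c) (\<lambda>i j. x * T i j) v =
   fun_scale x (block_action a b A B T v)"
  by (auto simp: block_action_def fun_scale_def fun_eq_iff algebra_simps sum_distrib_left)

text \<open>Only the corner of a product survives, formed from A of the left factor and B of the
  right one. Hence products of three vanish, and commutators do not see the corners T.\<close>

lemma block_action_comp:
  "block_action a b A B T (block_action a b A' B' T' v) =
   block_action a b (\<lambda>_ _. 0) (\<lambda>_ _. 0) (\<lambda>i j. \<Sum>c<2. A i c * B' j c) v"
proof
  fix k
  have "(\<Sum>c<2. A k c * (\<Sum>j<b. B' j c * v (a + 2 + j))) = (\<Sum>j<b. (\<Sum>c<2. A k c * B' j c) * v (a + 2 + j))"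
    unfolding sum_distrib_left sum_distrib_right by (subst sum.swap) (simp only: mult.assoc)
  then show "block_action a b A B T (block_action a b A' B' T' v) k =
      block_action a b (\<lambda>_ _. 0) (\<lambda>_ _. 0) (\<lambda>i j. \<Sum>c<2. A i c * B' j c) v k"
    by (simp add: block_action_def)
qed

lemma block_action_unit_A: "k < a \<Longrightarrow> c < 2 \<Longrightarrow> block_action a b A B T (unit_fun (a + c)) k = A k c"
  by (auto simp: block_action_def unit_fun_def if_distrib[of "\<lambda>x. _ * x"] cong: if_cong)

lemma block_action_unit_B: "j < b \<Longrightarrow> c < 2 \<Longrightarrow> block_action a b A B T (unit_fun (a + 2 + j)) (a + c) = B j c"
  by (auto simp: block_action_def unit_fun_def if_distrib[of "\<lambda>x. _ * x"] cong: if_cong)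

lemma block_action_unit_T: "k < a \<Longrightarrow> j < b \<Longrightarrow> block_action a b A B T (unit_fun (a + 2 + j)) k = T k j"
  by (auto simp: block_action_def unit_fun_def if_distrib[of "\<lambda>x. _ * x"] cong: if_cong)

lemma block_action_strictly_upper:
  assumes "block_index a 2 j \<le> block_index a 2 i" "j < a + 2 + b"
  shows "block_action a b A B T (unit_fun j) i = 0"
  using assms
  by (auto simp: block_action_def block_index_def unit_fun_def split: if_splits intro!: sum.neutral)

text \<open>Both orders of the indices are filled in so that \<open>skew_pairing\<close>, a sum over
  ordered pairs, sends the wedge of x and y to A(x) B(y) - A(y) B(x).\<close>

definition skew_of :: "(nat \<times> nat \<Rightarrow> 'k::field) \<Rightarrow> nat \<Rightarrow> nat \<Rightarrow> 'k" where
  "skew_of w p q = (if p < q then w (p, q) else if q < p then - w (q, p) else 0)"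

definition linear_form :: "nat \<Rightarrow> (nat \<Rightarrow> nat \<times> nat \<Rightarrow> 'k::field) \<Rightarrow> (nat \<Rightarrow> 'k) \<Rightarrow> nat \<Rightarrow> nat \<Rightarrow> 'k" where
  "linear_form r F x i c = (\<Sum>p<r. F i (p, c) * x p)"

lemma skew_pairing_add:
  "skew_pairing r F G (\<lambda>p q. \<Omega> p q + \<Omega>' p q) i j = skew_pairing r F G \<Omega> i j + skew_pairing r F G \<Omega>' i j"
  by (simp add: skew_pairing_def distrib_right sum.distrib)

lemma skew_pairing_scale: "skew_pairing r F G (\<lambda>p q. x * \<Omega> p q) i j = x * skew_pairing r F G \<Omega> i j"
  by (simp add: skew_pairing_def sum_distrib_left mult.assoc)

lemma skew_pairing_diff:
  "skew_pairing r F G (\<lambda>p q. \<Omega> p q - \<Omega>' p q) i j = skew_pairing r F G \<Omega> i j - skew_pairing r F G \<Omega>' i j"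
  by (simp add: skew_pairing_def left_diff_distrib sum_subtractf)

lemma skew_pairing_product:
  "skew_pairing r F G (\<lambda>p q. x p * y q) i j = (\<Sum>c<2. linear_form r F x i c * linear_form r G y j c)"
proof -
  have "skew_pairing r F G (\<lambda>p q. x p * y q) i j =
      (\<Sum>p<r. \<Sum>q<r. \<Sum>c<2. F i (p, c) * x p * (G j (q, c) * y q))"
    unfolding skew_pairing_def sum_distrib_left by (simp only: mult_ac)
  also have "\<dots> = (\<Sum>p<r. \<Sum>c<2. \<Sum>q<r. F i (p, c) * x p * (G j (q, c) * y q))"
    by (intro sum.cong refl sum.swap)
  also have "\<dots> = (\<Sum>c<2. \<Sum>p<r. \<Sum>q<r. F i (p, c) * x p * (G j (q, c) * y q))"
    by (rule sum.swap)
  also have "\<dots> = (\<Sum>c<2. linear_form r F x i c * linear_form r G y j c)"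
    unfolding linear_form_def sum_product ..
  finally show ?thesis .
qed

lemma skew_of_wedge: "skew_of (wedge x y) = (\<lambda>p q. x p * y q - y p * x q)"
  by (auto simp: skew_of_def wedge_def fun_eq_iff)

text \<open>The corner on the exterior square is the linear extension of the commutator of the outer
  blocks; on K^r itself it is chosen to be zero.\<close>

definition free_nil2_rep where
  "free_nil2_rep r a b F G = (\<lambda>(x, w). block_action a b (linear_form r F x) (linear_form r G x)
     (skew_pairing r F G (skew_of w)))"

lemma linear_form_add: "linear_form r F (x + y) = (\<lambda>i c. linear_form r F x i c + linear_form r F y i c)"
  by (simp add: linear_form_def fun_eq_iff distrib_left sum.distrib)

lemma linear_form_scale: "linear_form r F (fun_scale k x) = (\<lambda>i c. k * linear_form r F x i c)"
  by (simp add: linear_form_def fun_scale_def fun_eq_iff sum_distrib_left mult_ac)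

lemma linear_form_diff: "linear_form r F (\<lambda>p. x p - y p) i c = linear_form r F x i c - linear_form r F y i c"
  by (simp add: linear_form_def right_diff_distrib sum_subtractf)

lemma skew_of_add: "skew_of (w + z) = (\<lambda>p q. skew_of w p q + skew_of z p q)"
  by (auto simp: skew_of_def fun_eq_iff)

lemma skew_of_scale: "skew_of (fun_scale k w) = (\<lambda>p q. k * skew_of w p q)"
  by (auto simp: skew_of_def fun_scale_def fun_eq_iff)

lemma free_nil2_rep_add: "free_nil2_rep r a b F G (X + Y) v = free_nil2_rep r a b F G X v + free_nil2_rep r a b F G Y v"
proof (cases X, cases Y)
  fix x w y z assume "X = (x, w)" "Y = (y, z)"
  then show ?thesis
    by (simp add: free_nil2_rep_def linear_form_add skew_of_add skew_pairing_add[abs_def] flip: block_action_add)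
qed

lemma free_nil2_rep_scale:
  "free_nil2_rep r a b F G (free_nil2_scale k X) v = fun_scale k (free_nil2_rep r a b F G X v)"
proof (cases X)
  fix x w assume "X = (x, w)"
  then show ?thesis
    by (simp add: free_nil2_rep_def free_nil2_scale_def linear_form_scale skew_of_scale
        skew_pairing_scale[abs_def] flip: block_action_scale)
qed

lemma free_nil2_rep_bracket:
  "free_nil2_rep r a b F G (free_nil2_bracket X Y) v =
   free_nil2_rep r a b F G X (free_nil2_rep r a b F G Y v) - free_nil2_rep r a b F G Y (free_nil2_rep r a b F G X v)"
proof (cases X, cases Y)
  fix x w y z assume XY: "X = (x, w)" "Y = (y, z)"
  let ?AB = "\<lambda>x y i j. \<Sum>c<2. linear_form r F x i c * linear_form r G y j c"
  have T: "skew_pairing r F G (skew_of (wedge x y)) = (\<lambda>i j. ?AB x y i j - ?AB y x i j)"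
    unfolding skew_of_wedge by (intro ext) (simp only: skew_pairing_diff skew_pairing_product)
  have 0: "linear_form r H (0 :: nat \<Rightarrow> 'a) = (\<lambda>_ _. 0)" for H
    by (simp add: linear_form_def fun_eq_iff)
  show ?thesis
    unfolding XY free_nil2_rep_def free_nil2_bracket_def prod.case T 0 block_action_comp
    by (auto simp: block_action_def fun_eq_iff left_diff_distrib sum_subtractf)
qed

lemma lie_representation_free_nil2_rep:
  "lie_representation free_nil2_scale (free_nil2 r) free_nil2_bracket
     (fun_scale :: 'k::field_char_0 \<Rightarrow> _) (coord_space (a + 2 + b)) (free_nil2_rep r a b F G)"
proof (intro lie_representation.intro lie_algebra_free_nil2 fin_dim_coord_space
    lie_representation_axioms.intro)
  fix X :: "(nat \<Rightarrow> 'k) \<times> (nat \<times> nat \<Rightarrow> 'k)" and u v :: "nat \<Rightarrow> 'k" and c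
  show "free_nil2_rep r a b F G X v \<in> coord_space (a + 2 + b)"
    by (cases X) (simp only: free_nil2_rep_def prod.case block_action_in_coord_space)
  show "free_nil2_rep r a b F G X (u + v) = free_nil2_rep r a b F G X u + free_nil2_rep r a b F G X v"
    by (cases X) (simp add: free_nil2_rep_def block_action_add_vec)
  show "free_nil2_rep r a b F G X (fun_scale c v) = fun_scale c (free_nil2_rep r a b F G X v)"
    by (cases X) (simp add: free_nil2_rep_def block_action_scale_vec)
qed (simp_all add: free_nil2_rep_add free_nil2_rep_scale free_nil2_rep_bracket)

lemma nilrepresentation_free_nil2_rep:
  "nilrepresentation free_nil2_scale (free_nil2 r) free_nil2_bracket
     (fun_scale :: 'k::field_char_0 \<Rightarrow> _) (coord_space (a + 2 + b)) (free_nil2_rep r a b F G)"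
proof (intro nilrepresentation.intro lie_representation_free_nil2_rep nilrepresentation_axioms.intro)
  fix X :: "(nat \<Rightarrow> 'k) \<times> (nat \<times> nat \<Rightarrow> 'k)"
  have "(free_nil2_rep r a b F G X ^^ 3) v = 0" for v
    by (cases X) (simp add: free_nil2_rep_def block_action_comp numeral_3_eq_3,
        simp add: block_action_def fun_eq_iff)
  then show "\<exists>k. \<forall>v\<in>coord_space (a + 2 + b). (free_nil2_rep r a b F G X ^^ k) v = 0" by blast
qed

lemma representation_of_type_free_nil2_rep:
  "representation_of_type free_nil2_scale (free_nil2 r) free_nil2_bracket
     (fun_scale :: 'k::field_char_0 \<Rightarrow> _) (coord_space (a + 2 + b)) (free_nil2_rep r a b F G) a 2 b"
proof (intro representation_of_type.intro lie_representation_free_nil2_rep representation_of_type_axioms.intro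
    exI[of _ unit_fun] conjI ballI allI impI)
  let ?n = "a + 2 + b"
  show "fun_vs.ordered_basis ?n unit_fun (coord_space ?n :: (nat \<Rightarrow> 'k) set)"
    unfolding fun_vs.ordered_basis_def
    by (simp add: inj_on_subset[OF inj_unit_fun] independent_unit_fun span_unit_coord_space)
  fix X :: "(nat \<Rightarrow> 'k) \<times> (nat \<times> nat \<Rightarrow> 'k)" and i j
  assume ij: "i < ?n" "j < ?n" "block_index a 2 j \<le> block_index a 2 i"
  show "fun_vs.matrix_entry ?n unit_fun (free_nil2_rep r a b F G X) i j = 0"
    using ij unfolding fun_vs.matrix_entry_def
    by (cases X) (simp only: free_nil2_rep_def prod.case
        representation_unit_fun[OF block_action_in_coord_space ij(1)]
        block_action_strictly_upper[OF ij(3,2)])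
qed

text \<open>On the exterior square injectivity is the separating property. If all forms of F and G
  vanish at d in K^r, then the wedge of d with any basis vector is annihilated, hence zero, which
  forces d = 0.\<close>

lemma faithful_representation_free_nil2_rep:
  fixes F G :: "nat \<Rightarrow> nat \<times> nat \<Rightarrow> 'k::field_char_0"
  assumes r: "2 \<le> r"
    and sep: "separating r a b F G"
  shows "faithful_representation free_nil2_scale (free_nil2 r) free_nil2_bracket
     fun_scale (coord_space (a + 2 + b)) (free_nil2_rep r a b F G)"
proof (intro faithful_representation.intro lie_representation_free_nil2_rep
    faithful_representation_axioms.intro inj_onI)
  fix X Y :: "(nat \<Rightarrow> 'k) \<times> (nat \<times> nat \<Rightarrow> 'k)"
  assume X: "X \<in> free_nil2 r" and Y: "Y \<in> free_nil2 r"
    and eq: "restrict (free_nil2_rep r a b F G X) (coord_space (a + 2 + b)) =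
      restrict (free_nil2_rep r a b F G Y) (coord_space (a + 2 + b))"
  obtain x w y z where XY: "X = (x, w)" "Y = (y, z)" by fastforce
  have x: "x p \<noteq> 0 \<Longrightarrow> p < r" and y: "y p \<noteq> 0 \<Longrightarrow> p < r" for p
    using X Y by (auto simp: XY free_nil2_def)
  have w: "w (p, q) \<noteq> 0 \<Longrightarrow> p < q \<and> q < r" and z: "z (p, q) \<noteq> 0 \<Longrightarrow> p < q \<and> q < r" for p q
    using X Y by (auto simp: XY free_nil2_def)
  have ev: "free_nil2_rep r a b F G X (unit_fun m) k = free_nil2_rep r a b F G Y (unit_fun m) k"
    if "m < a + 2 + b" for m k
  proof -
    have "(unit_fun m :: nat \<Rightarrow> 'k) \<in> coord_space (a + 2 + b)"
      using that by (auto simp: coord_space_def unit_fun_def)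
    then show ?thesis using fun_cong[OF eq, of "unit_fun m"] by simp
  qed
  have A: "linear_form r F x i c = linear_form r F y i c" if "i < a" "c < 2" for i c
  proof -
    have "a + c < a + 2 + b" using that by simp
    from ev[OF this, of i] show ?thesis
      by (simp only: XY free_nil2_rep_def prod.case block_action_unit_A[OF that])
  qed
  have B: "linear_form r G x j c = linear_form r G y j c" if "j < b" "c < 2" for j c
  proof -
    have "a + 2 + j < a + 2 + b" using that by simp
    from ev[OF this, of "a + c"] show ?thesis
      by (simp only: XY free_nil2_rep_def prod.case block_action_unit_B[OF that])
  qed
  have T: "skew_pairing r F G (skew_of w) i j = skew_pairing r F G (skew_of z) i j" if "i < a" "j < b" for i j
  proof -
    have "a + 2 + j < a + 2 + b" using that by simp
    from ev[OF this, of i] show ?thesis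
      by (simp only: XY free_nil2_rep_def prod.case block_action_unit_T[OF that])
  qed
  have "skew_of w p q - skew_of z p q = 0" for p q
  proof (rule separatingD[OF sep])
    show "skew_of w p q - skew_of z p q = - (skew_of w q p - skew_of z q p)" for p q
      by (auto simp: skew_of_def)
    show "p < r" if "skew_of w p q - skew_of z p q \<noteq> 0" for p q
    proof (rule ccontr)
      assume "\<not> p < r"
      then have "w (p, q) = 0" "w (q, p) = 0" "z (p, q) = 0" "z (q, p) = 0"
        using w[of p q] w[of q p] z[of p q] z[of q p] by force+
      then show False using that by (simp add: skew_of_def split: if_splits)
    qed
  qed (simp add: skew_pairing_diff T)
  then have "w (p, q) = z (p, q)" if "p < q" for p q
    using that by (metis right_minus_eq skew_of_def)
  then have wz: "w = z" using w z by (metis ext surj_pair)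
  define d where "d p = x p - y p" for p
  have dA: "linear_form r F d i c = 0" if "i < a" "c < 2" for i c
    using A that unfolding d_def by (simp add: linear_form_diff)
  have dB: "linear_form r G d j c = 0" if "j < b" "c < 2" for j c
    using B that unfolding d_def by (simp add: linear_form_diff)
  have d: "m < r" if "d m \<noteq> 0" for m
    using that x[of m] y[of m] by (cases "x m = 0") (auto simp: d_def)
  have "d k = 0" for k
  proof -
    \<comment> \<open>An index other than k, available because r >= 2: the entry (k, q) of the wedge
      of d with the basis vector at q is \<open>d k\<close>.\<close>
    define q where "q = (if k = 0 then 1 else 0 :: nat)"
    have q: "q < r" "q \<noteq> k" using r by (auto simp: q_def)
    have "d k * unit_fun q q - unit_fun q k * d q = 0"
    proof (rule separatingD[OF sep, where \<Omega> = "\<lambda>m n. d m * unit_fun q n - unit_fun q m * d n"])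
      show "m < r" if "d m * unit_fun q n - unit_fun q m * d n \<noteq> 0" for m n
        using that d[of m] q by (auto simp: unit_fun_def split: if_splits)
    qed (simp_all add: skew_pairing_diff skew_pairing_product dA dB)
    then show ?thesis using q by (simp add: unit_fun_def)
  qed
  then show "X = Y" using wz by (simp add: XY d_def fun_eq_iff)
qed

section \<open>Integer square roots and the final bound\<close>

lemma integer_square_roots_bounds:
  assumes n: "1 \<le> n" and ab: "(a, b) = integer_square_roots n"
  shows "b \<le> a" "a \<le> b + 1" "n \<le> a * b" "int (a + b) = \<lceil>sqrt (4 * real n)\<rceil>"
proof -
  have a: "a = nat \<lceil>sqrt (real n)\<rceil>" and b: "b = (if a * (a - 1) \<ge> n then a - 1 else a)"
    using ab by (auto simp: integer_square_roots_def Let_def)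
  have s: "0 < sqrt (real n)" using n by simp
  have "real a = of_int \<lceil>sqrt (real n)\<rceil>" unfolding a using s by (simp add: of_nat_nat)
  then have "sqrt (real n) \<le> real a" "real a - 1 < sqrt (real n)" by linarith+
  then have up: "real n \<le> real a ^ 2" and a1: "1 \<le> a" and lo: "(real a - 1) ^ 2 < real n"
  proof -
    assume h: "sqrt (real n) \<le> real a" "real a - 1 < sqrt (real n)"
    show "real n \<le> real a ^ 2" using h(1) by (rule sqrt_le_D)
    show a1: "1 \<le> a" using h(1) s by (cases a) auto
    show "(real a - 1) ^ 2 < real n"
      using power_strict_mono[OF h(2), of 2] a1 n by simp
  qed
  have eq: "int (a + b) = \<lceil>sqrt (4 * real n)\<rceil>"
    if "(real a + real b - 1) ^ 2 < 4 * real n" "4 * real n \<le> (real a + real b) ^ 2"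
  proof (rule ceiling_unique[symmetric])
    show "real_of_int (int (a + b)) - 1 < sqrt (4 * real n)"
      using real_less_rsqrt[OF that(1)] by simp
    show "sqrt (4 * real n) \<le> real_of_int (int (a + b))"
      using real_le_lsqrt[OF _ that(2)] by simp
  qed
  show "b \<le> a" "a \<le> b + 1" using b a1 by auto
  show "n \<le> a * b" using b up by (auto simp: power2_eq_square simp flip: of_nat_mult)
  \<comment> \<open>For b = a - 1: 4 (a - 1)^2 < 4 n <= 4 a (a - 1) <= (2 a - 1)^2. For b = a:
    integrality gives a (a - 1) + 1 <= n, so (2 a - 1)^2 = 4 a (a - 1) + 1 < 4 n <= 4 a^2.\<close>
  show "int (a + b) = \<lceil>sqrt (4 * real n)\<rceil>"
  proof (cases "n \<le> a * (a - 1)")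
    case True
    then have "real n \<le> real a * (real a - 1)"
      using a1 by (metis of_nat_1 of_nat_diff of_nat_le_iff of_nat_mult)
    moreover have b': "real b = real a - 1" using b True a1 by (simp add: of_nat_diff)
    ultimately show ?thesis using lo
      by (intro eq) (simp_all add: b' power2_eq_square algebra_simps)
  next
    case False
    then have "a * (a - 1) + 1 \<le> n" by simp
    then have "real (a * (a - 1) + 1) \<le> real n" by (rule of_nat_mono)
    then have "real a * (real a - 1) + 1 \<le> real n" using a1 by (simp add: of_nat_diff)
    moreover have b': "real b = real a" using b False by simp
    ultimately show ?thesis using up
      by (intro eq) (simp_all add: b' power2_eq_square algebra_simps)
  qed
qed

theorem theorem4p2:
  fixes r a b :: nat
  assumes "r \<ge> 2"
    and "(a, b) = integer_square_roots (r choose 2)"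
  shows "(\<exists>(V :: (nat \<Rightarrow> 'k::field_char_0) set) \<pi>.
            faithful_representation free_nil2_scale (free_nil2 r) free_nil2_bracket fun_scale V \<pi> \<and>
            nilrepresentation free_nil2_scale (free_nil2 r) free_nil2_bracket fun_scale V \<pi> \<and>
            representation_of_type free_nil2_scale (free_nil2 r) free_nil2_bracket fun_scale V \<pi> a 2 b) \<and>
         minimal_faithful_dim (free_nil2_scale :: 'k \<Rightarrow> _) (free_nil2 r) free_nil2_bracket \<le> a + b + 2 \<and>
         int (a + b + 2) = \<lceil>sqrt (2 * real r * (real r - 1))\<rceil> + 2"
proof -
  have "even (r * (r - 1))" by (cases r) simp_all
  then have n: "2 * (r choose 2) = r * (r - 1)" by (simp add: choose_two)
  have "2 * 1 \<le> r * (r - 1)" using assms(1) by (intro mult_le_mono) simp_all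
  then have n1: "1 \<le> r choose 2" using n by simp
  note ab = integer_square_roots_bounds[OF n1 assms(2)]
  have "r * (r - 1) \<le> 2 * a * b" using ab(3) n by simp
  then obtain F G :: "nat \<Rightarrow> nat \<times> nat \<Rightarrow> 'k" where FG: "separating r a b F G"
    by (rule exists_separating_forms[OF assms(1) ab(1,2)])
  note faithful = faithful_representation_free_nil2_rep[OF assms(1) FG]
  have four: "4 * real (r choose 2) = 2 * real r * (real r - 1)"
  proof -
    have "real (2 * (r choose 2)) = real (r * (r - 1))" by (simp only: n)
    then show ?thesis using assms(1) by (simp add: of_nat_diff)
  qed
  have "minimal_faithful_dim (free_nil2_scale :: 'k \<Rightarrow> _) (free_nil2 r) free_nil2_bracket \<le> a + b + 2"
    using minimal_faithful_dim_le[OF faithful] by (simp add: dim_coord_space)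
  moreover have "int (a + b + 2) = \<lceil>sqrt (2 * real r * (real r - 1))\<rceil> + 2"
    using ab(4) unfolding four by simp
  ultimately show ?thesis
    by (intro conjI exI[of _ "coord_space (a + 2 + b)"] exI[of _ "free_nil2_rep r a b F G"] faithful
        nilrepresentation_free_nil2_rep representation_of_type_free_nil2_rep)
qed

end
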